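(* Let $S$ be an inverse monoid. Then $\mathcal{FR}_{R_s}(S)\simeq E(S^{pr})\rtimes S$ as restriction monoids.
   Context: Restriction monoids. A restriction semigroup is an algebra $(T;\cdot,{}^*,{}^+)$ with $(T;\cdot)$ a semigroup satisfying $x^+x=x$, $x^+y^+=y^+x^+$, $(x^+y)^+=x^+y^+$, $xy^+=(xy)^+x$; $xx^*=x$, $x^*y^*=y^*x^*$, $(xy^* )^*=x^*y^*$, $x^*y=y(xy)^*$; $(x^+)^*=x^+$, $(x^* )^+=x^*$. A restriction monoid is a restriction semigroup with an identity element, in signature $(\cdot,{}^*,{}^+,1)$; morphisms preserve all operations. Every inverse monoid is a restriction monoid with $a^*=a^{-1}a$, $a^+=aa^{-1}$. $E(T)$ denotes the set of idempotents of an inverse monoid $T$, a semilattice under $e\le f$ iff $e=ef$. $\mathcal{FR}_{R_s}(S)$, the free restriction monoid over $S$ with respect to strong premorphisms, is the restriction monoid generated by the set $\{\lfloor s\rfloor:s\in S\}$ subject to the relations $\lfloor1\rfloor=1$, $\lfloor s\rfloor\lfloor t\rfloor=\lfloor s\rfloor^+\lfloor st\rfloor$, $\lfloor s\rfloor\lfloor t\rfloor=\lfloor st\rfloor\lfloor t\rfloor^*$ ($s,t\in S$). $S^{pr}$ is the Lawson–Margolis–Steinberg generalized prefix expansion of $S$. In its standard model, $S^{pr}$ is the set of pairs $(A,s)$ where $s\in S$ and $A$ is a finite subset of $S$ with $s, ss^{-1}\in A$ and $aa^{-1}=ss^{-1}$ for all $a\in A$, with multiplication $(A,s)(B,t)=\big((st)(st)^{-1}A\cup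 sB,\ st\big)$ and identity $(\{1\},1)$; it is an inverse monoid with $(A,s)^{-1}=(s^{-1}A,s^{-1})$. Write $[s]=(\{s,ss^{-1}\},s)\in S^{pr}$ for $s\in S$. $E(S^{pr})\rtimes S=\{(e,s)\in E(S^{pr})\times S: e\le [s]^+\}$ is the restriction monoid with identity $(1,1)$ and operations $(e,s)(f,t)=(e([s]f)^+,st)$, $(e,s)^*=((e[s])^*,1)$, $(e,s)^+=(e,1)$, where the operations ${}^*,{}^+$ inside are those of the inverse monoid $S^{pr}$. *)

theory Defs
  imports "HOL-Algebra.Group"
begin

section \<open>Inverse monoids\<close>

locale inverse_monoid = monoid S for S (structure) +
  assumes unique_inverse:
    "x \<in> carrier S \<Longrightarrow> \<exists>!y. y \<in> carrier S \<and> x \<otimes> y \<otimes> x = x \<and> y \<otimes> x \<otimes> y = y"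

text \<open>HOL-Algebra's \<open>m_inv\<close> is the two-sided inverse of a unit; this is the inverse in the
  sense of semigroup theory.\<close>

definition iinv :: "('a, 'b) monoid_scheme \<Rightarrow> 'a \<Rightarrow> 'a" where
  "iinv S x = (THE y. y \<in> carrier S \<and> x \<otimes>\<^bsub>S\<^esub> y \<otimes>\<^bsub>S\<^esub> x = x \<and> y \<otimes>\<^bsub>S\<^esub> x \<otimes>\<^bsub>S\<^esub> y = y)"

definition inv_star :: "('a, 'b) monoid_scheme \<Rightarrow> 'a \<Rightarrow> 'a" where
  "inv_star S x = iinv S x \<otimes>\<^bsub>S\<^esub> x"

definition inv_plus :: "('a, 'b) monoid_scheme \<Rightarrow> 'a \<Rightarrow> 'a" where
  "inv_plus S x = x \<otimes>\<^bsub>S\<^esub> iinv S x"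

definition idems :: "('a, 'b) monoid_scheme \<Rightarrow> 'a set" where
  "idems S = {e \<in> carrier S. e \<otimes>\<^bsub>S\<^esub> e = e}"

definition idem_le :: "('a, 'b) monoid_scheme \<Rightarrow> 'a \<Rightarrow> 'a \<Rightarrow> bool" where
  "idem_le S e f \<longleftrightarrow> e = e \<otimes>\<^bsub>S\<^esub> f"


section \<open>Restriction monoids\<close>

record 'a restriction_monoid = "'a monoid" +
  rstar :: "'a \<Rightarrow> 'a"
  rplus :: "'a \<Rightarrow> 'a"

locale restriction_monoid = monoid T
  for T :: "('a, 'b) restriction_monoid_scheme" (structure) +
  assumes rstar_closed: "x \<in> carrier T \<Longrightarrow> rstar T x \<in> carrier T"
    and rplus_closed: "x \<in> carrier T \<Longrightarrow> rplus T x \<in> carrier T"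
    and rplus_left: "x \<in> carrier T \<Longrightarrow> rplus T x \<otimes> x = x"
    and rplus_comm: "\<lbrakk>x \<in> carrier T; y \<in> carrier T\<rbrakk> \<Longrightarrow>
          rplus T x \<otimes> rplus T y = rplus T y \<otimes> rplus T x"
    and rplus_mult: "\<lbrakk>x \<in> carrier T; y \<in> carrier T\<rbrakk> \<Longrightarrow>
          rplus T (rplus T x \<otimes> y) = rplus T x \<otimes> rplus T y"
    and rplus_ample: "\<lbrakk>x \<in> carrier T; y \<in> carrier T\<rbrakk> \<Longrightarrow>
          x \<otimes> rplus T y = rplus T (x \<otimes> y) \<otimes> x"
    and rstar_right: "x \<in> carrier T \<Longrightarrow> x \<otimes> rstar T x = x"
    and rstar_comm: "\<lbrakk>x \<in> carrier T; y \<in> carrier T\<rbrakk> \<Longrightarrow>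
          rstar T x \<otimes> rstar T y = rstar T y \<otimes> rstar T x"
    and rstar_mult: "\<lbrakk>x \<in> carrier T; y \<in> carrier T\<rbrakk> \<Longrightarrow>
          rstar T (x \<otimes> rstar T y) = rstar T x \<otimes> rstar T y"
    and rstar_ample: "\<lbrakk>x \<in> carrier T; y \<in> carrier T\<rbrakk> \<Longrightarrow>
          rstar T x \<otimes> y = y \<otimes> rstar T (x \<otimes> y)"
    and rstar_rplus: "x \<in> carrier T \<Longrightarrow> rstar T (rplus T x) = rplus T x"
    and rplus_rstar: "x \<in> carrier T \<Longrightarrow> rplus T (rstar T x) = rstar T x"

definition restriction_hom ::
  "('a, 'c) restriction_monoid_scheme \<Rightarrow> ('b, 'd) restriction_monoid_scheme \<Rightarrow> ('a \<Rightarrow> 'b) set" where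
  "restriction_hom T U = {f \<in> carrier T \<rightarrow> carrier U.
     (\<forall>x\<in>carrier T. \<forall>y\<in>carrier T. f (x \<otimes>\<^bsub>T\<^esub> y) = f x \<otimes>\<^bsub>U\<^esub> f y) \<and>
     (\<forall>x\<in>carrier T. f (rstar T x) = rstar U (f x)) \<and>
     (\<forall>x\<in>carrier T. f (rplus T x) = rplus U (f x)) \<and>
     f \<one>\<^bsub>T\<^esub> = \<one>\<^bsub>U\<^esub>}"

definition restriction_iso ::
  "('a, 'c) restriction_monoid_scheme \<Rightarrow> ('b, 'd) restriction_monoid_scheme \<Rightarrow> bool"
  (infix "\<simeq>\<^sub>R" 60) where
  "T \<simeq>\<^sub>R U \<longleftrightarrow> restriction_monoid T \<and> restriction_monoid U \<and>
     (\<exists>f \<in> restriction_hom T U. bij_betw f (carrier T) (carrier U))"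


section \<open>Restriction monoids given by generators and relations\<close>

datatype (gens: 'x) rterm =
    Gen 'x
  | One
  | Mul "'x rterm" "'x rterm"
  | Star "'x rterm"
  | Plus "'x rterm"

definition rterms :: "'x set \<Rightarrow> 'x rterm set" where
  "rterms X = {u. gens u \<subseteq> X}"

text \<open>The least congruence on the algebra of terms over \<open>X\<close> that contains the relations \<open>R\<close> and
  all instances of the restriction monoid identities.\<close>

inductive_set rcong :: "'x set \<Rightarrow> ('x rterm \<times> 'x rterm) set \<Rightarrow> ('x rterm \<times> 'x rterm) set"
  for X :: "'x set" and R :: "('x rterm \<times> 'x rterm) set" where
  rel: "\<lbrakk>(u, v) \<in> R; u \<in> rterms X; v \<in> rterms X\<rbrakk> \<Longrightarrow> (u, v) \<in> rcong X R"
| refl: "u \<in> rterms X \<Longrightarrow> (u, u) \<in> rcong X R"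
| sym: "(u, v) \<in> rcong X R \<Longrightarrow> (v, u) \<in> rcong X R"
| trans: "\<lbrakk>(u, v) \<in> rcong X R; (v, w) \<in> rcong X R\<rbrakk> \<Longrightarrow> (u, w) \<in> rcong X R"
| Mul: "\<lbrakk>(u, u') \<in> rcong X R; (v, v') \<in> rcong X R\<rbrakk> \<Longrightarrow> (Mul u v, Mul u' v') \<in> rcong X R"
| Star: "(u, u') \<in> rcong X R \<Longrightarrow> (Star u, Star u') \<in> rcong X R"
| Plus: "(u, u') \<in> rcong X R \<Longrightarrow> (Plus u, Plus u') \<in> rcong X R"
| assoc: "\<lbrakk>u \<in> rterms X; v \<in> rterms X; w \<in> rterms X\<rbrakk> \<Longrightarrow>
    (Mul (Mul u v) w, Mul u (Mul v w)) \<in> rcong X R"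
| one_left: "u \<in> rterms X \<Longrightarrow> (Mul One u, u) \<in> rcong X R"
| one_right: "u \<in> rterms X \<Longrightarrow> (Mul u One, u) \<in> rcong X R"
| plus_left: "u \<in> rterms X \<Longrightarrow> (Mul (Plus u) u, u) \<in> rcong X R"
| plus_comm: "\<lbrakk>u \<in> rterms X; v \<in> rterms X\<rbrakk> \<Longrightarrow>
    (Mul (Plus u) (Plus v), Mul (Plus v) (Plus u)) \<in> rcong X R"
| plus_mult: "\<lbrakk>u \<in> rterms X; v \<in> rterms X\<rbrakk> \<Longrightarrow>
    (Plus (Mul (Plus u) v), Mul (Plus u) (Plus v)) \<in> rcong X R"
| plus_ample: "\<lbrakk>u \<in> rterms X; v \<in> rterms X\<rbrakk> \<Longrightarrow>
    (Mul u (Plus v), Mul (Plus (Mul u v)) u) \<in> rcong X R"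
| star_right: "u \<in> rterms X \<Longrightarrow> (Mul u (Star u), u) \<in> rcong X R"
| star_comm: "\<lbrakk>u \<in> rterms X; v \<in> rterms X\<rbrakk> \<Longrightarrow>
    (Mul (Star u) (Star v), Mul (Star v) (Star u)) \<in> rcong X R"
| star_mult: "\<lbrakk>u \<in> rterms X; v \<in> rterms X\<rbrakk> \<Longrightarrow>
    (Star (Mul u (Star v)), Mul (Star u) (Star v)) \<in> rcong X R"
| star_ample: "\<lbrakk>u \<in> rterms X; v \<in> rterms X\<rbrakk> \<Longrightarrow>
    (Mul (Star u) v, Mul v (Star (Mul u v))) \<in> rcong X R"
| star_plus: "u \<in> rterms X \<Longrightarrow> (Star (Plus u), Plus u) \<in> rcong X R"
| plus_star: "u \<in> rterms X \<Longrightarrow> (Plus (Star u), Star u) \<in> rcong X R"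

text \<open>The unions below range over representatives and are unions of equal classes, because
  \<open>rcong\<close> is compatible with the operations.\<close>

definition presented ::
  "'x set \<Rightarrow> ('x rterm \<times> 'x rterm) set \<Rightarrow> 'x rterm set restriction_monoid" where
  "presented X R = \<lparr>
     carrier = rterms X // rcong X R,
     mult = (\<lambda>A B. \<Union>u\<in>A. \<Union>v\<in>B. rcong X R `` {Mul u v}),
     one = rcong X R `` {One},
     rstar = (\<lambda>A. \<Union>u\<in>A. rcong X R `` {Star u}),
     rplus = (\<lambda>A. \<Union>u\<in>A. rcong X R `` {Plus u})\<rparr>"


section \<open>The free restriction monoid with respect to strong premorphisms\<close>

definition strong_rels :: "('a, 'b) monoid_scheme \<Rightarrow> ('a rterm \<times> 'a rterm) set" where
  "strong_rels S =
     {(Gen \<one>\<^bsub>S\<^esub>, One)}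
   \<union> {(Mul (Gen s) (Gen t), Mul (Plus (Gen s)) (Gen (s \<otimes>\<^bsub>S\<^esub> t))) | s t.
        s \<in> carrier S \<and> t \<in> carrier S}
   \<union> {(Mul (Gen s) (Gen t), Mul (Gen (s \<otimes>\<^bsub>S\<^esub> t)) (Star (Gen t))) | s t.
        s \<in> carrier S \<and> t \<in> carrier S}"

definition FR_Rs :: "('a, 'b) monoid_scheme \<Rightarrow> 'a rterm set restriction_monoid" where
  "FR_Rs S = presented (carrier S) (strong_rels S)"


section \<open>The generalized prefix expansion and the semidirect product\<close>

definition Spr :: "('a, 'b) monoid_scheme \<Rightarrow> ('a set \<times> 'a) monoid" where
  "Spr S = \<lparr>
     carrier = {(A, s). s \<in> carrier S \<and> A \<subseteq> carrier S \<and> finite A \<and>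
                  s \<in> A \<and> inv_plus S s \<in> A \<and> (\<forall>a\<in>A. inv_plus S a = inv_plus S s)},
     mult = (\<lambda>(A, s) (B, t).
               ((\<lambda>a. inv_plus S (s \<otimes>\<^bsub>S\<^esub> t) \<otimes>\<^bsub>S\<^esub> a) ` A \<union> (\<lambda>b. s \<otimes>\<^bsub>S\<^esub> b) ` B, s \<otimes>\<^bsub>S\<^esub> t)),
     one = ({\<one>\<^bsub>S\<^esub>}, \<one>\<^bsub>S\<^esub>)\<rparr>"

definition pr_gen :: "('a, 'b) monoid_scheme \<Rightarrow> 'a \<Rightarrow> 'a set \<times> 'a" where
  "pr_gen S s = ({s, inv_plus S s}, s)"

text \<open>The second components carry only the multiplication of \<open>S\<close>; both unary operations of the
  product send them to \<open>\<one>\<close>.\<close>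

definition EprS :: "('a, 'b) monoid_scheme \<Rightarrow> (('a set \<times> 'a) \<times> 'a) restriction_monoid" where
  "EprS S = \<lparr>
     carrier = {(e, s). e \<in> idems (Spr S) \<and> s \<in> carrier S \<and>
                  idem_le (Spr S) e (inv_plus (Spr S) (pr_gen S s))},
     mult = (\<lambda>(e, s) (f, t).
               (e \<otimes>\<^bsub>Spr S\<^esub> inv_plus (Spr S) (pr_gen S s \<otimes>\<^bsub>Spr S\<^esub> f), s \<otimes>\<^bsub>S\<^esub> t)),
     one = (\<one>\<^bsub>Spr S\<^esub>, \<one>\<^bsub>S\<^esub>),
     rstar = (\<lambda>(e, s). (inv_star (Spr S) (e \<otimes>\<^bsub>Spr S\<^esub> pr_gen S s), \<one>\<^bsub>S\<^esub>)),
     rplus = (\<lambda>(e, s). (e, \<one>\<^bsub>S\<^esub>))\<rparr>"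

end

theory Submission
  imports Defs "HOL-Algebra.FiniteProduct"
begin

text \<open>Write \<open>[s]\<close> for the generators, both of the prefix expansion and of the free restriction
  monoid. The map \<open>[s] \<mapsto> ([s]\<^sup>+, s)\<close> is a strong premorphism into the semidirect product, so
  it extends to the free restriction monoid. Its inverse sends \<open>((A, e), s)\<close> to the normal form
  \<open>(\<Prod>a\<in>A. [a]\<^sup>+) [s]\<close>. That normal forms multiply as in the semidirect product rests on
  \<open>[e]\<^sup>+ [es]\<^sup>+ = [e]\<^sup>+ [s]\<^sup>+\<close> for idempotent \<open>e\<close>: the element \<open>[e]\<close> is idempotent, though in
  general not a projection, and an idempotent \<open>x\<close> of a restriction monoid satisfies \<open>x\<^sup>* = x\<^sup>+\<close>.\<close>

section \<open>Inverse monoids as restriction monoids\<close>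

text \<open>The obstacle is a mismatch between sets and products of projections. Idempotents
  \<open>(A, e)\<close> and \<open>(B, f)\<close> of \<open>Spr S\<close> multiply to the set
  \<open>ef(A \<union> B)\<close>, whereas their images multiply to the product over
  \<open>A \<union> B\<close>. The factor \<open>ef\<close> can be stripped off each element in the
  presence of \<open>[ef]\<^sup>+\<close>, which is present because \<open>ef\<close> belongs to the
  product set. The star operation causes a second difficulty: a pair \<open>((A, e), s)\<close>
  guarantees \<open>es \<in> A\<close> but not \<open>s \<in> A\<close>, so \<open>s\<close> must
  first be exchanged for \<open>es\<close>. The element \<open>[e]\<close> restricted to the product
  over \<open>A\<close> is an idempotent that makes the exchange possible. The remaining star is
  then turned into a plus, because evaluating \<open>[u^-1][u]\<close> by both defining relations
  identifies the star of \<open>[u]\<close> with \<open>[u^-1]\<^sup>+\<close>. The restriction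
  identities of the semidirect product are proved for an arbitrary strong premorphism, away from
  finite sets.\<close>

context inverse_monoid
begin

lemma iinv_spec:
  assumes "x \<in> carrier S"
  shows "iinv S x \<in> carrier S \<and> x \<otimes> iinv S x \<otimes> x = x \<and> iinv S x \<otimes> x \<otimes> iinv S x = iinv S x"
  unfolding iinv_def using theI'[OF unique_inverse[OF assms]] .

lemma iinv_closed [simp, intro]: "x \<in> carrier S \<Longrightarrow> iinv S x \<in> carrier S"
  using iinv_spec by blast

text \<open>Bracketed to the right, so that these equations apply after normalisation by
  \<open>m_assoc\<close>; the next lemma adds a trailing factor for the same reason.\<close>

lemma iinv_regular [simp]:
  assumes "x \<in> carrier S"
  shows "x \<otimes> (iinv S x \<otimes> x) = x" "iinv S x \<otimes> (x \<otimes> iinv S x) = iinv S x"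
  using iinv_spec[OF assms] assms by (metis iinv_closed m_assoc)+

lemma iinv_regular_left [simp]:
  assumes "x \<in> carrier S" "z \<in> carrier S"
  shows "x \<otimes> (iinv S x \<otimes> (x \<otimes> z)) = x \<otimes> z" "iinv S x \<otimes> (x \<otimes> (iinv S x \<otimes> z)) = iinv S x \<otimes> z"
  using iinv_spec[OF assms(1)] assms by (metis iinv_closed m_assoc m_closed)+

lemma iinv_eqI:
  assumes "x \<in> carrier S" "y \<in> carrier S" "x \<otimes> (y \<otimes> x) = x" "y \<otimes> (x \<otimes> y) = y"
  shows "iinv S x = y"
  using unique_inverse[OF assms(1)] iinv_spec[OF assms(1)] assms by (metis m_assoc)

lemma iinv_iinv [simp]: "x \<in> carrier S \<Longrightarrow> iinv S (iinv S x) = x"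
  by (rule iinv_eqI) auto

section \<open>Idempotents are closed under products and commute\<close>

lemma idems_closed: "e \<in> idems S \<Longrightarrow> e \<in> carrier S"
  by (simp add: idems_def)

lemma idems_idem: "e \<in> idems S \<Longrightarrow> e \<otimes> e = e"
  by (simp add: idems_def)

lemma idems_idem_left: "e \<in> idems S \<Longrightarrow> z \<in> carrier S \<Longrightarrow> e \<otimes> (e \<otimes> z) = e \<otimes> z"
  by (metis idems_closed idems_idem m_assoc)

lemma iinv_idem: "e \<in> idems S \<Longrightarrow> iinv S e = e"
  by (rule iinv_eqI) (auto simp: idems_def)

text \<open>If \<open>x\<close> is the inverse of \<open>ef\<close>, then \<open>fxe\<close> is also
  an inverse of \<open>ef\<close> and is visibly idempotent. Uniqueness gives
  \<open>x = fxe\<close>, and an idempotent is its own inverse, so \<open>ef = x\<close>.\<close>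

lemma idems_mult:
  assumes e: "e \<in> idems S" and f: "f \<in> idems S"
  shows "e \<otimes> f \<in> idems S"
proof -
  note c = idems_closed[OF e] idems_closed[OF f]
  define x where "x = iinv S (e \<otimes> f)"
  have x: "x \<in> carrier S" using c by (simp add: x_def)
  have r: "e \<otimes> (f \<otimes> (x \<otimes> (e \<otimes> f))) = e \<otimes> f" "x \<otimes> (e \<otimes> (f \<otimes> x)) = x"
    using iinv_regular[of "e \<otimes> f"] c x unfolding x_def[symmetric] by (simp_all add: m_assoc)
  have r': "x \<otimes> (e \<otimes> (f \<otimes> (x \<otimes> e))) = x \<otimes> e"
    using r(2) c x by (metis m_assoc m_closed)
  have "x = f \<otimes> (x \<otimes> e)"
    unfolding x_def
  proof (rule iinv_eqI)
    show "e \<otimes> f \<otimes> (f \<otimes> (iinv S (e \<otimes> f) \<otimes> e) \<otimes> (e \<otimes> f)) = e \<otimes> f"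
      using r c x e f by (simp add: x_def[symmetric] m_assoc idems_idem_left)
    show "f \<otimes> (iinv S (e \<otimes> f) \<otimes> e) \<otimes> (e \<otimes> f \<otimes> (f \<otimes> (iinv S (e \<otimes> f) \<otimes> e))) = f \<otimes> (iinv S (e \<otimes> f) \<otimes> e)"
      using r' c x e f by (simp add: x_def[symmetric] m_assoc idems_idem_left)
  qed (use c x in auto)
  moreover have "f \<otimes> (x \<otimes> e) \<otimes> (f \<otimes> (x \<otimes> e)) = f \<otimes> (x \<otimes> e)"
    using r' c x by (simp add: m_assoc)
  ultimately have "x \<in> idems S"
    using x by (simp add: idems_def)
  moreover from this have "e \<otimes> f = x"
    using iinv_idem[of x] c by (simp add: x_def)
  ultimately show ?thesis by simp
qed

text \<open>Both products are idempotent, so \<open>fe\<close> is an inverse of \<open>ef\<close>,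
  while \<open>ef\<close> is its own inverse.\<close>

lemma idems_comm:
  assumes e: "e \<in> idems S" and f: "f \<in> idems S"
  shows "e \<otimes> f = f \<otimes> e"
proof -
  note c = idems_closed[OF e] idems_closed[OF f]
  have ef: "e \<otimes> (f \<otimes> (e \<otimes> f)) = e \<otimes> f"
    using idems_mult[OF e f] c by (simp add: idems_def m_assoc)
  have fe: "f \<otimes> (e \<otimes> (f \<otimes> e)) = f \<otimes> e"
    using idems_mult[OF f e] c by (simp add: idems_def m_assoc)
  have "iinv S (e \<otimes> f) = f \<otimes> e"
    by (rule iinv_eqI) (use c e f ef fe in \<open>simp_all add: m_assoc idems_idem_left\<close>)
  with iinv_idem[OF idems_mult[OF e f]] show ?thesis by simp
qed

section \<open>The restriction identities in an inverse monoid\<close>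

lemma inv_plus_idem [simp]: "x \<in> carrier S \<Longrightarrow> inv_plus S x \<in> idems S"
  by (simp add: idems_def inv_plus_def m_assoc)

lemma inv_star_idem [simp]: "x \<in> carrier S \<Longrightarrow> inv_star S x \<in> idems S"
  by (simp add: idems_def inv_star_def m_assoc)

lemma inv_plus_closed [simp, intro]: "x \<in> carrier S \<Longrightarrow> inv_plus S x \<in> carrier S"
  by (simp add: inv_plus_def)

lemma inv_star_closed [simp, intro]: "x \<in> carrier S \<Longrightarrow> inv_star S x \<in> carrier S"
  by (simp add: inv_star_def)

lemma inv_plus_of_idem: "e \<in> idems S \<Longrightarrow> inv_plus S e = e"
  by (simp add: inv_plus_def iinv_idem idems_idem)

lemma inv_star_of_idem: "e \<in> idems S \<Longrightarrow> inv_star S e = e"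
  by (simp add: inv_star_def iinv_idem idems_idem)

lemma inv_plus_left: "x \<in> carrier S \<Longrightarrow> inv_plus S x \<otimes> x = x"
  by (simp add: inv_plus_def m_assoc)

lemma inv_star_right: "x \<in> carrier S \<Longrightarrow> x \<otimes> inv_star S x = x"
  by (simp add: inv_star_def)

text \<open>In the regularity equations the idempotents \<open>inv_plus S y\<close> and
  \<open>inv_star S x\<close> meet in the middle, where they commute.\<close>

lemma iinv_mult:
  assumes x: "x \<in> carrier S" and y: "y \<in> carrier S"
  shows "iinv S (x \<otimes> y) = iinv S y \<otimes> iinv S x"
proof (rule iinv_eqI)
  have comm: "y \<otimes> (iinv S y \<otimes> (iinv S x \<otimes> x)) = iinv S x \<otimes> (x \<otimes> (y \<otimes> iinv S y))"
    using idems_comm[OF inv_plus_idem[OF y] inv_star_idem[OF x]] x y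
    by (simp add: inv_plus_def inv_star_def m_assoc)
  have l: "y \<otimes> (iinv S y \<otimes> (iinv S x \<otimes> (x \<otimes> z))) = iinv S x \<otimes> (x \<otimes> (y \<otimes> (iinv S y \<otimes> z)))"
    if "z \<in> carrier S" for z
    using arg_cong[OF comm, of "\<lambda>w. w \<otimes> z"] x y that by (simp add: m_assoc)
  show "x \<otimes> y \<otimes> (iinv S y \<otimes> iinv S x \<otimes> (x \<otimes> y)) = x \<otimes> y"
    using x y by (simp add: m_assoc l)
  show "iinv S y \<otimes> iinv S x \<otimes> (x \<otimes> y \<otimes> (iinv S y \<otimes> iinv S x)) = iinv S y \<otimes> iinv S x"
    using x y by (simp add: m_assoc l[symmetric])
qed (use x y in auto)

text \<open>Insert \<open>inv_star S x\<close> to the right of \<open>x\<close> and commute it past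
  \<open>inv_plus S y\<close>; the result is \<open>x y y^-1 x^-1 x\<close>.\<close>

lemma inv_plus_ample:
  assumes x: "x \<in> carrier S" and y: "y \<in> carrier S"
  shows "x \<otimes> inv_plus S y = inv_plus S (x \<otimes> y) \<otimes> x"
proof -
  have "x \<otimes> inv_plus S y = x \<otimes> (inv_star S x \<otimes> inv_plus S y)"
    using x y by (simp add: m_assoc[symmetric] inv_star_right)
  also have "\<dots> = x \<otimes> (inv_plus S y \<otimes> inv_star S x)"
    using x y by (simp add: idems_comm)
  finally show ?thesis
    using x y by (simp add: inv_plus_def inv_star_def iinv_mult m_assoc)
qed

lemma inv_star_ample:
  assumes x: "x \<in> carrier S" and y: "y \<in> carrier S"
  shows "inv_star S x \<otimes> y = y \<otimes> inv_star S (x \<otimes> y)"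
proof -
  have "inv_star S x \<otimes> y = inv_star S x \<otimes> inv_plus S y \<otimes> y"
    using x y by (simp add: m_assoc inv_plus_left)
  also have "\<dots> = inv_plus S y \<otimes> inv_star S x \<otimes> y"
    using x y by (simp add: idems_comm)
  finally show ?thesis
    using x y by (simp add: inv_plus_def inv_star_def iinv_mult m_assoc)
qed

lemma inv_plus_mult:
  assumes e: "e \<in> idems S" and y: "y \<in> carrier S"
  shows "inv_plus S (e \<otimes> y) = e \<otimes> inv_plus S y"
proof -
  have c: "e \<in> carrier S" using e by (rule idems_closed)
  have "inv_plus S (e \<otimes> y) = e \<otimes> (inv_plus S y \<otimes> e)"
    using c y by (simp add: inv_plus_def iinv_mult iinv_idem[OF e] m_assoc)
  also have "\<dots> = e \<otimes> inv_plus S y"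
    using c y e by (simp add: idems_comm[of _ e] idems_idem_left)
  finally show ?thesis .
qed

lemma inv_star_mult:
  assumes x: "x \<in> carrier S" and e: "e \<in> idems S"
  shows "inv_star S (x \<otimes> e) = inv_star S x \<otimes> e"
proof -
  have c: "e \<in> carrier S" using e by (rule idems_closed)
  have "inv_star S (x \<otimes> e) = e \<otimes> (inv_star S x \<otimes> e)"
    using c x by (simp add: inv_star_def iinv_mult iinv_idem[OF e] m_assoc)
  also have "\<dots> = inv_star S x \<otimes> e"
    using c x e by (simp add: idems_comm[of e "inv_star S x"] m_assoc[symmetric]) (simp add: idems_idem m_assoc)
  finally show ?thesis .
qed

end

text \<open>Bundling the derived operations with the monoid makes the general theory available both
  for \<open>S\<close> and for \<open>Spr S\<close>, the target of \<open>pr_gen\<close>.\<close>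

definition inv_restriction :: "('a, 'b) monoid_scheme \<Rightarrow> 'a restriction_monoid" where
  "inv_restriction S = \<lparr>carrier = carrier S, mult = mult S, one = one S,
     rstar = inv_star S, rplus = inv_plus S\<rparr>"

lemma inv_restriction_simps [simp]:
  "carrier (inv_restriction S) = carrier S" "mult (inv_restriction S) = mult S"
  "one (inv_restriction S) = one S"
  "rstar (inv_restriction S) = inv_star S" "rplus (inv_restriction S) = inv_plus S"
  by (simp_all add: inv_restriction_def)

lemma (in inverse_monoid) restriction_monoid_inv_restriction:
  "restriction_monoid (inv_restriction S)"
  by unfold_locales
    (simp_all add: m_assoc inv_plus_left inv_star_right inv_plus_ample[symmetric]
      inv_star_ample[symmetric] inv_plus_mult inv_star_mult inv_plus_of_idem inv_star_of_idem
      idems_comm[OF inv_plus_idem inv_plus_idem] idems_comm[OF inv_star_idem inv_star_idem])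

text \<open>Given two inverses \<open>y\<close> and \<open>z\<close> of \<open>x\<close>, write
  \<open>y = (yx)(zx)y\<close>. Swapping \<open>yx\<close> with \<open>zx\<close>, and then
  \<open>xz\<close> with \<open>xy\<close>, turns this into \<open>z\<close>.\<close>

lemma inverse_monoidI:
  fixes M (structure)
  assumes "monoid M"
    and reg: "\<And>x. x \<in> carrier M \<Longrightarrow> \<exists>y\<in>carrier M. x \<otimes> y \<otimes> x = x \<and> y \<otimes> x \<otimes> y = y"
    and comm: "\<And>e f. e \<in> idems M \<Longrightarrow> f \<in> idems M \<Longrightarrow> e \<otimes> f = f \<otimes> e"
  shows "inverse_monoid M"
proof -
  interpret monoid M by fact
  have eq: "y = z"
    if c: "x \<in> carrier M" "y \<in> carrier M" "z \<in> carrier M"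
      and y: "x \<otimes> y \<otimes> x = x" "y \<otimes> x \<otimes> y = y" and z: "x \<otimes> z \<otimes> x = x" "z \<otimes> x \<otimes> z = z" for x y z
  proof -
    note y' = y[unfolded m_assoc[OF c(1,2,1)] m_assoc[OF c(2,1,2)]]
    note z' = z[unfolded m_assoc[OF c(1,3,1)] m_assoc[OF c(3,1,3)]]
    have y_left: "y \<otimes> (x \<otimes> (y \<otimes> w)) = y \<otimes> w" "x \<otimes> (y \<otimes> (x \<otimes> w)) = x \<otimes> w"
      and z_left: "z \<otimes> (x \<otimes> (z \<otimes> w)) = z \<otimes> w" "x \<otimes> (z \<otimes> (x \<otimes> w)) = x \<otimes> w"
      if "w \<in> carrier M" for w
      using y z c that by (simp_all flip: m_assoc)
    have idem: "x \<otimes> y \<in> idems M" "x \<otimes> z \<in> idems M" "y \<otimes> x \<in> idems M" "z \<otimes> x \<in> idems M"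
      using c y' z' by (simp_all add: idems_def m_assoc)
    have "y = (y \<otimes> x) \<otimes> (z \<otimes> x) \<otimes> y"
      using c y' z' y_left z_left by (simp add: m_assoc)
    also have "\<dots> = (z \<otimes> x) \<otimes> (y \<otimes> x) \<otimes> y"
      using comm idem by simp
    also have "\<dots> = z \<otimes> ((x \<otimes> z) \<otimes> (x \<otimes> y))"
      using c y' z' y_left z_left by (simp add: m_assoc)
    also have "\<dots> = z \<otimes> ((x \<otimes> y) \<otimes> (x \<otimes> z))"
      using comm idem by simp
    also have "\<dots> = z"
      using c y' z' y_left z_left by (simp add: m_assoc)
    finally show ?thesis .
  qed
  show ?thesis
    by unfold_locales (use reg eq in blast)
qed

section \<open>Restriction monoids\<close>

text \<open>The semilattice of projections. In a general restriction monoid an idempotent may fail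
  to be a projection; in \<open>inv_restriction S\<close> the two notions coincide.\<close>

definition projs :: "('a, 'b) restriction_monoid_scheme \<Rightarrow> 'a set" where
  "projs T = {e \<in> carrier T. rplus T e = e}"

context restriction_monoid
begin

lemmas restriction_closed [simp, intro] = rstar_closed rplus_closed

lemma rplus_rplus [simp]: "x \<in> carrier T \<Longrightarrow> rplus T (rplus T x) = rplus T x"
  by (metis rplus_closed rplus_rstar rstar_rplus)

lemma rstar_rstar [simp]: "x \<in> carrier T \<Longrightarrow> rstar T (rstar T x) = rstar T x"
  by (metis rstar_closed rplus_rstar rstar_rplus)

lemma rplus_in_projs [simp, intro]: "x \<in> carrier T \<Longrightarrow> rplus T x \<in> projs T"
  by (simp add: projs_def)

lemma rstar_in_projs [simp, intro]: "x \<in> carrier T \<Longrightarrow> rstar T x \<in> projs T"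
  by (simp add: projs_def rplus_rstar)

lemma projs_closed: "e \<in> projs T \<Longrightarrow> e \<in> carrier T"
  by (simp add: projs_def)

lemma rplus_proj: "e \<in> projs T \<Longrightarrow> rplus T e = e"
  by (simp add: projs_def)

lemma rstar_proj: "e \<in> projs T \<Longrightarrow> rstar T e = e"
  by (metis projs_closed rplus_proj rstar_rplus)

lemma projs_comm: "e \<in> projs T \<Longrightarrow> f \<in> projs T \<Longrightarrow> e \<otimes> f = f \<otimes> e"
  by (metis projs_closed rplus_proj rplus_comm)

lemma projs_idem: "e \<in> projs T \<Longrightarrow> e \<otimes> e = e"
  by (metis projs_closed rplus_proj rplus_left)

lemma projs_left_comm:
  "e \<in> projs T \<Longrightarrow> f \<in> projs T \<Longrightarrow> x \<in> carrier T \<Longrightarrow> e \<otimes> (f \<otimes> x) = f \<otimes> (e \<otimes> x)"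
  by (metis projs_closed projs_comm m_assoc)

lemma projs_idem_left: "e \<in> projs T \<Longrightarrow> x \<in> carrier T \<Longrightarrow> e \<otimes> (e \<otimes> x) = e \<otimes> x"
  by (metis projs_closed projs_idem m_assoc)

lemma rplus_proj_mult: "e \<in> projs T \<Longrightarrow> x \<in> carrier T \<Longrightarrow> rplus T (e \<otimes> x) = e \<otimes> rplus T x"
  by (metis projs_closed rplus_mult rplus_proj)

lemma rstar_mult_proj: "x \<in> carrier T \<Longrightarrow> e \<in> projs T \<Longrightarrow> rstar T (x \<otimes> e) = rstar T x \<otimes> e"
  by (metis projs_closed rstar_mult rstar_proj)

lemma projs_mult [simp, intro]: "e \<in> projs T \<Longrightarrow> f \<in> projs T \<Longrightarrow> e \<otimes> f \<in> projs T"
  by (metis projs_closed rplus_proj_mult rplus_in_projs m_closed rplus_proj)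

lemma one_in_projs [simp, intro]: "\<one> \<in> projs T"
  by (metis one_closed projs_closed r_one rplus_in_projs rplus_left)

lemma rplus_one: "rplus T \<one> = \<one>"
  by (rule rplus_proj) simp

lemma proj_ample: "x \<in> carrier T \<Longrightarrow> e \<in> projs T \<Longrightarrow> x \<otimes> e = rplus T (x \<otimes> e) \<otimes> x"
  by (metis projs_closed rplus_ample rplus_proj)

lemma rplus_mult_absorb:
  assumes "x \<in> carrier T" "y \<in> carrier T"
  shows "rplus T x \<otimes> rplus T (x \<otimes> y) = rplus T (x \<otimes> y)"
  using rplus_mult[of x "x \<otimes> y"] assms by (metis m_assoc m_closed rplus_closed rplus_left)

lemma rstar_mult_absorb:
  assumes "x \<in> carrier T" "y \<in> carrier T"
  shows "rstar T (x \<otimes> y) \<otimes> rstar T y = rstar T (x \<otimes> y)"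
  using rstar_mult[of "x \<otimes> y" y] assms by (metis m_assoc m_closed rstar_closed rstar_right)

text \<open>The left congruence condition: apply \<open>rplus\<close> to the ample identity and
  absorb the factor \<open>rplus T x\<close>, which lies above
  \<open>rplus T (x \<otimes> y)\<close>.\<close>

lemma rplus_mult_rplus:
  assumes "x \<in> carrier T" "y \<in> carrier T"
  shows "rplus T (x \<otimes> rplus T y) = rplus T (x \<otimes> y)"
proof -
  have "rplus T (x \<otimes> rplus T y) = rplus T (x \<otimes> y) \<otimes> rplus T x"
    using assms by (simp only: rplus_ample rplus_mult m_closed)
  then show ?thesis
    using assms rplus_mult_absorb rplus_comm by (metis m_closed)
qed

lemma rstar_rstar_mult:
  assumes "x \<in> carrier T" "y \<in> carrier T"
  shows "rstar T (rstar T x \<otimes> y) = rstar T (x \<otimes> y)"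
proof -
  have "rstar T (rstar T x \<otimes> y) = rstar T y \<otimes> rstar T (x \<otimes> y)"
    using assms by (simp only: rstar_ample rstar_mult m_closed)
  then show ?thesis
    using assms rstar_mult_absorb rstar_comm by (metis m_closed)
qed

text \<open>For idempotent \<open>x\<close> the ample identities say that \<open>rstar T x\<close>
  fixes \<open>x\<close> from the left and \<open>rplus T x\<close> fixes it from the right. Each
  projection is therefore below the other.\<close>

lemma idempotent_rstar_eq_rplus:
  assumes x: "x \<in> carrier T" and idem: "x \<otimes> x = x"
  shows "rstar T x = rplus T x"
proof -
  have "rstar T x \<otimes> x = x"
    using rstar_ample[OF x x] idem by (simp add: rstar_right x)
  then have "rstar T x \<otimes> rplus T x = rplus T x"
    using rplus_proj_mult[of "rstar T x" x] x by simp
  moreover have "x \<otimes> rplus T x = x"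
    using rplus_ample[OF x x] idem by (simp add: rplus_left x)
  then have "rstar T x \<otimes> rplus T x = rstar T x"
    using rstar_mult_proj[of x "rplus T x"] x by simp
  ultimately show ?thesis by simp
qed

text \<open>The product \<open>x e\<close> of an idempotent and a projection is again idempotent, so its two
  projections agree.\<close>

lemma idempotent_mult_proj:
  assumes x: "x \<in> carrier T" and idem: "x \<otimes> x = x" and e: "e \<in> projs T"
  shows "rplus T (x \<otimes> e) = rplus T x \<otimes> e"
proof -
  note c = projs_closed[OF e]
  define r where "r = rplus T (x \<otimes> e)"
  have r: "x \<otimes> e = r \<otimes> x" "r \<in> projs T" "r \<in> carrier T"
    using proj_ample[OF x e] x c by (auto simp: r_def)
  have rx: "r \<otimes> (x \<otimes> e) = x \<otimes> e"
    unfolding r_def using x c by (simp add: rplus_left)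
  have "x \<otimes> e \<otimes> (x \<otimes> e) = r \<otimes> x \<otimes> (x \<otimes> e)"
    using r by simp
  also have "\<dots> = r \<otimes> (x \<otimes> e)"
    using x c r idem by (metis m_assoc m_closed)
  finally have "rstar T (x \<otimes> e) = r"
    using idempotent_rstar_eq_rplus[of "x \<otimes> e"] x c rx unfolding r_def by simp
  then show ?thesis
    using rstar_mult_proj[OF x e] idempotent_rstar_eq_rplus[OF x idem] by (simp add: r_def)
qed

end

text \<open>All axioms beyond closure are identities, so they pull back along an injective map
  preserving the operations, even though \<open>T\<close> is not yet known to be a monoid.\<close>

lemma restriction_monoid_embedding:
  fixes T :: "('a, 'b) restriction_monoid_scheme" and U :: "('c, 'd) restriction_monoid_scheme"
  assumes "restriction_monoid U"
    and j: "j \<in> carrier T \<rightarrow> carrier U" "inj_on j (carrier T)"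
    and closed: "\<one>\<^bsub>T\<^esub> \<in> carrier T"
      "\<And>x y. x \<in> carrier T \<Longrightarrow> y \<in> carrier T \<Longrightarrow> x \<otimes>\<^bsub>T\<^esub> y \<in> carrier T"
      "\<And>x. x \<in> carrier T \<Longrightarrow> rstar T x \<in> carrier T"
      "\<And>x. x \<in> carrier T \<Longrightarrow> rplus T x \<in> carrier T"
    and hom: "j \<one>\<^bsub>T\<^esub> = \<one>\<^bsub>U\<^esub>"
      "\<And>x y. x \<in> carrier T \<Longrightarrow> y \<in> carrier T \<Longrightarrow> j (x \<otimes>\<^bsub>T\<^esub> y) = j x \<otimes>\<^bsub>U\<^esub> j y"
      "\<And>x. x \<in> carrier T \<Longrightarrow> j (rstar T x) = rstar U (j x)"
      "\<And>x. x \<in> carrier T \<Longrightarrow> j (rplus T x) = rplus U (j x)"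
  shows "restriction_monoid T"
proof -
  interpret U: restriction_monoid U by fact
  have jc: "j x \<in> carrier U" if "x \<in> carrier T" for x
    using j that by auto
  have eq: "x = y" if "j x = j y" "x \<in> carrier T" "y \<in> carrier T" for x y
    using j that by (auto dest: inj_onD)
  show ?thesis
    apply unfold_locales
    subgoal by (simp add: closed)
    subgoal by (rule eq) (simp_all add: closed hom jc U.m_assoc)
    subgoal by (simp add: closed)
    subgoal by (rule eq) (simp_all add: closed hom jc)
    subgoal by (rule eq) (simp_all add: closed hom jc)
    subgoal by (simp add: closed)
    subgoal by (simp add: closed)
    subgoal by (rule eq) (simp_all add: closed hom jc U.rplus_left)
    subgoal by (rule eq) (simp_all add: closed hom jc U.rplus_comm[OF jc jc])
    subgoal by (rule eq) (simp_all add: closed hom jc U.rplus_mult)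
    subgoal by (rule eq) (simp_all add: closed hom jc U.rplus_ample)
    subgoal by (rule eq) (simp_all add: closed hom jc U.rstar_right)
    subgoal by (rule eq) (simp_all add: closed hom jc U.rstar_comm[OF jc jc])
    subgoal by (rule eq) (simp_all add: closed hom jc U.rstar_mult)
    subgoal by (rule eq) (simp_all add: closed hom jc U.rstar_ample[symmetric])
    subgoal by (rule eq) (simp_all add: closed hom jc U.rstar_rplus)
    subgoal by (rule eq) (simp_all add: closed hom jc U.rplus_rstar)
    done
qed

text \<open>Any monoid is a restriction monoid with both unary operations constantly
  \<open>\<one>\<close>; this is the direct product of \<open>T\<close> with \<open>S\<close> so
  regarded.\<close>

definition restriction_times_monoid ::
  "('a, 'b) restriction_monoid_scheme \<Rightarrow> ('c, 'd) monoid_scheme \<Rightarrow> ('a \<times> 'c) restriction_monoid" where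
  "restriction_times_monoid T S = \<lparr>
     carrier = carrier T \<times> carrier S,
     mult = (\<lambda>(x, s) (y, t). (x \<otimes>\<^bsub>T\<^esub> y, s \<otimes>\<^bsub>S\<^esub> t)),
     one = (\<one>\<^bsub>T\<^esub>, \<one>\<^bsub>S\<^esub>),
     rstar = (\<lambda>(x, s). (rstar T x, \<one>\<^bsub>S\<^esub>)),
     rplus = (\<lambda>(x, s). (rplus T x, \<one>\<^bsub>S\<^esub>))\<rparr>"

lemma restriction_times_monoid_simps [simp]:
  "carrier (restriction_times_monoid T S) = carrier T \<times> carrier S"
  "(x, s) \<otimes>\<^bsub>restriction_times_monoid T S\<^esub> (y, t) = (x \<otimes>\<^bsub>T\<^esub> y, s \<otimes>\<^bsub>S\<^esub> t)"
  "\<one>\<^bsub>restriction_times_monoid T S\<^esub> = (\<one>\<^bsub>T\<^esub>, \<one>\<^bsub>S\<^esub>)"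
  "rstar (restriction_times_monoid T S) (x, s) = (rstar T x, \<one>\<^bsub>S\<^esub>)"
  "rplus (restriction_times_monoid T S) (x, s) = (rplus T x, \<one>\<^bsub>S\<^esub>)"
  by (simp_all add: restriction_times_monoid_def)

lemma restriction_monoid_times_monoid:
  assumes "restriction_monoid T" "monoid S"
  shows "restriction_monoid (restriction_times_monoid T S)"
proof -
  interpret T: restriction_monoid T by fact
  interpret S: monoid S by fact
  show ?thesis
    by unfold_locales
      (auto simp: T.m_assoc S.m_assoc T.rplus_left T.rplus_mult T.rplus_ample[symmetric]
        T.rstar_right T.rstar_mult T.rstar_ample[symmetric] T.rstar_rplus T.rplus_rstar
        intro: T.rplus_comm T.rstar_comm)
qed

section \<open>Strong premorphisms\<close>

text \<open>These are the defining relations of \<open>FR_Rs S\<close> read in \<open>T\<close>, so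
  such a \<open>\<gamma>\<close> is exactly an assignment to the generators that respects the
  presentation.\<close>

locale strong_premorphism = S: monoid S + T: restriction_monoid T
  for S :: "('a, 'b) monoid_scheme" (structure)
    and T :: "('c, 'd) restriction_monoid_scheme" and \<gamma> :: "'a \<Rightarrow> 'c" +
  assumes gamma_closed [simp, intro]: "s \<in> carrier S \<Longrightarrow> \<gamma> s \<in> carrier T"
    and gamma_one [simp]: "\<gamma> \<one> = \<one>\<^bsub>T\<^esub>"
    and gamma_plus: "s \<in> carrier S \<Longrightarrow> t \<in> carrier S \<Longrightarrow>
          \<gamma> s \<otimes>\<^bsub>T\<^esub> \<gamma> t = rplus T (\<gamma> s) \<otimes>\<^bsub>T\<^esub> \<gamma> (s \<otimes> t)"
    and gamma_star: "s \<in> carrier S \<Longrightarrow> t \<in> carrier S \<Longrightarrow>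
          \<gamma> s \<otimes>\<^bsub>T\<^esub> \<gamma> t = \<gamma> (s \<otimes> t) \<otimes>\<^bsub>T\<^esub> rstar T (\<gamma> t)"

text \<open>Abstract form of \<open>EprS S\<close>, recovered by
  \<open>T = inv_restriction (Spr S)\<close> and \<open>\<gamma> = pr_gen S\<close>; projections
  take the place of idempotents.\<close>

definition semidirect ::
  "('a, 'b) monoid_scheme \<Rightarrow> ('c, 'd) restriction_monoid_scheme \<Rightarrow> ('a \<Rightarrow> 'c) \<Rightarrow>
    ('c \<times> 'a) restriction_monoid" where
  "semidirect S T \<gamma> = \<lparr>
     carrier = {(e, s). e \<in> projs T \<and> s \<in> carrier S \<and> e = e \<otimes>\<^bsub>T\<^esub> rplus T (\<gamma> s)},
     mult = (\<lambda>(e, s) (f, t). (e \<otimes>\<^bsub>T\<^esub> rplus T (\<gamma> s \<otimes>\<^bsub>T\<^esub> f), s \<otimes>\<^bsub>S\<^esub> t)),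
     one = (\<one>\<^bsub>T\<^esub>, \<one>\<^bsub>S\<^esub>),
     rstar = (\<lambda>(e, s). (rstar T (e \<otimes>\<^bsub>T\<^esub> \<gamma> s), \<one>\<^bsub>S\<^esub>)),
     rplus = (\<lambda>(e, s). (e, \<one>\<^bsub>S\<^esub>))\<rparr>"

lemma semidirect_simps [simp]:
  "(e, s) \<in> carrier (semidirect S T \<gamma>) \<longleftrightarrow>
     e \<in> projs T \<and> s \<in> carrier S \<and> e = e \<otimes>\<^bsub>T\<^esub> rplus T (\<gamma> s)"
  "(e, s) \<otimes>\<^bsub>semidirect S T \<gamma>\<^esub> (f, t) = (e \<otimes>\<^bsub>T\<^esub> rplus T (\<gamma> s \<otimes>\<^bsub>T\<^esub> f), s \<otimes>\<^bsub>S\<^esub> t)"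
  "\<one>\<^bsub>semidirect S T \<gamma>\<^esub> = (\<one>\<^bsub>T\<^esub>, \<one>\<^bsub>S\<^esub>)"
  "rstar (semidirect S T \<gamma>) (e, s) = (rstar T (e \<otimes>\<^bsub>T\<^esub> \<gamma> s), \<one>\<^bsub>S\<^esub>)"
  "rplus (semidirect S T \<gamma>) (e, s) = (e, \<one>\<^bsub>S\<^esub>)"
  by (simp_all add: semidirect_def)

context strong_premorphism
begin

abbreviation "TS \<equiv> restriction_times_monoid T S"
abbreviation "semi \<equiv> semidirect S T \<gamma>"

text \<open>The semidirect product embeds into \<open>T \<times> S\<close>, where both unary operations kill the
  second component.\<close>

definition emb :: "'c \<times> 'a \<Rightarrow> 'c \<times> 'a" where
  "emb = (\<lambda>(e, s). (e \<otimes>\<^bsub>T\<^esub> \<gamma> s, s))"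

lemma emb_simp [simp]: "emb (e, s) = (e \<otimes>\<^bsub>T\<^esub> \<gamma> s, s)"
  by (simp add: emb_def)

text \<open>Since \<open>f\<close> is below \<open>rplus T (\<gamma> t)\<close>, the new projection
  \<open>q\<close> is below that of \<open>\<gamma> s\<close> times \<open>\<gamma> t\<close>. By
  \<open>gamma_plus\<close> the latter is \<open>rplus T (\<gamma> s)\<close> times
  \<open>rplus T (\<gamma> (s \<otimes> t))\<close>.\<close>

lemma semidirect_mult_closed:
  assumes "(e, s) \<in> carrier semi" "(f, t) \<in> carrier semi"
  shows "(e, s) \<otimes>\<^bsub>semi\<^esub> (f, t) \<in> carrier semi"
proof -
  have e: "e \<in> projs T" "e = e \<otimes>\<^bsub>T\<^esub> rplus T (\<gamma> s)" "s \<in> carrier S"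
    and f: "f \<in> projs T" "f = f \<otimes>\<^bsub>T\<^esub> rplus T (\<gamma> t)" "t \<in> carrier S"
    using assms by simp_all
  note c = T.projs_closed[OF e(1)] T.projs_closed[OF f(1)]
  define q where "q = rplus T (\<gamma> s \<otimes>\<^bsub>T\<^esub> f)"
  have q: "q \<in> projs T" "q \<in> carrier T"
    using e(3) c by (simp_all add: q_def)
  have "f = rplus T (\<gamma> t) \<otimes>\<^bsub>T\<^esub> f"
    using f T.projs_comm[of f "rplus T (\<gamma> t)"] by auto
  then have "q = rplus T (\<gamma> s \<otimes>\<^bsub>T\<^esub> rplus T (\<gamma> t) \<otimes>\<^bsub>T\<^esub> f)"
    using e(3) f(3) c by (simp add: q_def T.m_assoc)
  then have "q = rplus T (\<gamma> s \<otimes>\<^bsub>T\<^esub> rplus T (\<gamma> t)) \<otimes>\<^bsub>T\<^esub> q"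
    using T.rplus_mult_absorb[of "\<gamma> s \<otimes>\<^bsub>T\<^esub> rplus T (\<gamma> t)" f] e(3) f(3) c by simp
  also have "rplus T (\<gamma> s \<otimes>\<^bsub>T\<^esub> rplus T (\<gamma> t)) = rplus T (\<gamma> s) \<otimes>\<^bsub>T\<^esub> rplus T (\<gamma> (s \<otimes> t))"
    using e(3) f(3) by (simp add: T.rplus_mult_rplus gamma_plus T.rplus_mult)
  also have "\<dots> \<otimes>\<^bsub>T\<^esub> q = rplus T (\<gamma> s) \<otimes>\<^bsub>T\<^esub> q \<otimes>\<^bsub>T\<^esub> rplus T (\<gamma> (s \<otimes> t))"
    using e(3) f(3) q T.projs_comm[of q "rplus T (\<gamma> (s \<otimes> t))"] by (simp add: T.m_assoc)
  finally have "e \<otimes>\<^bsub>T\<^esub> q \<otimes>\<^bsub>T\<^esub> rplus T (\<gamma> (s \<otimes> t)) = e \<otimes>\<^bsub>T\<^esub> q"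
    using e(3) f(3) q c by (metis S.m_closed T.m_assoc T.m_closed T.projs_idem T.rplus_closed
        T.rplus_in_projs gamma_closed)
  then show ?thesis
    using e(1,3) f(3) q by (simp add: q_def[symmetric])
qed

text \<open>Moving \<open>f\<close> left across \<open>\<gamma> s\<close> by the ample identity
  produces the projection \<open>p\<close> of the semidirect product. Then \<open>gamma_plus\<close>
  merges \<open>\<gamma> s\<close> with \<open>\<gamma> t\<close>, and \<open>e\<close> absorbs the
  factor \<open>rplus T (\<gamma> s)\<close> this creates.\<close>

lemma emb_mult:
  assumes "(e, s) \<in> carrier semi" "(f, t) \<in> carrier semi"
  shows "emb ((e, s) \<otimes>\<^bsub>semi\<^esub> (f, t)) = emb (e, s) \<otimes>\<^bsub>TS\<^esub> emb (f, t)"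
proof -
  have e: "e \<in> projs T" "e \<otimes>\<^bsub>T\<^esub> rplus T (\<gamma> s) = e" "s \<in> carrier S"
    and f: "f \<in> projs T" "f \<otimes>\<^bsub>T\<^esub> rplus T (\<gamma> t) = f" "t \<in> carrier S"
    using assms by auto
  note c = T.projs_closed[OF e(1)] T.projs_closed[OF f(1)]
  define p where "p = rplus T (\<gamma> s \<otimes>\<^bsub>T\<^esub> f)"
  have p: "p \<in> projs T" "p \<in> carrier T" using e c by (auto simp: p_def)
  have "(e \<otimes>\<^bsub>T\<^esub> \<gamma> s) \<otimes>\<^bsub>T\<^esub> (f \<otimes>\<^bsub>T\<^esub> \<gamma> t) = e \<otimes>\<^bsub>T\<^esub> (\<gamma> s \<otimes>\<^bsub>T\<^esub> f) \<otimes>\<^bsub>T\<^esub> \<gamma> t"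
    using e f c by (simp add: T.m_assoc)
  also have "\<gamma> s \<otimes>\<^bsub>T\<^esub> f = p \<otimes>\<^bsub>T\<^esub> \<gamma> s"
    using e f unfolding p_def by (intro T.proj_ample) auto
  also have "e \<otimes>\<^bsub>T\<^esub> (p \<otimes>\<^bsub>T\<^esub> \<gamma> s) \<otimes>\<^bsub>T\<^esub> \<gamma> t = e \<otimes>\<^bsub>T\<^esub> (p \<otimes>\<^bsub>T\<^esub> (\<gamma> s \<otimes>\<^bsub>T\<^esub> \<gamma> t))"
    using e f c p by (simp add: T.m_assoc)
  also have "\<dots> = p \<otimes>\<^bsub>T\<^esub> (e \<otimes>\<^bsub>T\<^esub> rplus T (\<gamma> s) \<otimes>\<^bsub>T\<^esub> \<gamma> (s \<otimes> t))"
    using e(1,3) f c p by (simp add: T.m_assoc T.projs_left_comm[of e p] gamma_plus)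
  also have "\<dots> = e \<otimes>\<^bsub>T\<^esub> p \<otimes>\<^bsub>T\<^esub> \<gamma> (s \<otimes> t)"
    unfolding e(2) using e(1,3) f c p by (simp add: T.m_assoc T.projs_left_comm[of e p])
  finally show ?thesis
    by (simp add: p_def)
qed

text \<open>The condition that \<open>e\<close> is below \<open>rplus T (\<gamma> s)\<close> is what
  allows \<open>e\<close> to be recovered, as the \<open>rplus\<close> of the first
  component.\<close>

lemma inj_on_emb: "inj_on emb (carrier semi)"
proof (rule inj_onI; clarify)
  fix e s f t
  assume a: "(e, s) \<in> carrier semi" "(f, t) \<in> carrier semi" "emb (e, s) = emb (f, t)"
  have "e = rplus T (e \<otimes>\<^bsub>T\<^esub> \<gamma> s)" "f = rplus T (f \<otimes>\<^bsub>T\<^esub> \<gamma> t)"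
    using a by (simp_all add: T.rplus_proj_mult)
  moreover have "e \<otimes>\<^bsub>T\<^esub> \<gamma> s = f \<otimes>\<^bsub>T\<^esub> \<gamma> t" "s = t"
    using a(3) by auto
  ultimately show "e = f \<and> s = t" by metis
qed

lemma emb_in: "emb \<in> carrier semi \<rightarrow> carrier TS"
proof (rule funcsetI, clarify)
  fix e s assume "(e, s) \<in> carrier semi"
  then have "e \<in> carrier T" "s \<in> carrier S" by (simp_all add: T.projs_closed)
  then show "emb (e, s) \<in> carrier TS" by simp
qed

lemma emb_rstar: "x \<in> carrier semi \<Longrightarrow> emb (rstar semi x) = rstar TS (emb x)"
  by (cases x) (simp add: T.projs_closed)

lemma emb_rplus: "x \<in> carrier semi \<Longrightarrow> emb (rplus semi x) = rplus TS (emb x)"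
  by (cases x) (simp add: T.projs_closed T.rplus_proj_mult)

lemma restriction_monoid_semidirect: "restriction_monoid semi"
proof (rule restriction_monoid_embedding[OF _ emb_in inj_on_emb])
  show "restriction_monoid TS"
    by (rule restriction_monoid_times_monoid) unfold_locales
  show "x \<otimes>\<^bsub>semi\<^esub> y \<in> carrier semi" "emb (x \<otimes>\<^bsub>semi\<^esub> y) = emb x \<otimes>\<^bsub>TS\<^esub> emb y"
    if "x \<in> carrier semi" "y \<in> carrier semi" for x y
    using semidirect_mult_closed emb_mult that by (metis surj_pair)+
qed (auto simp: emb_rstar emb_rplus T.rplus_one T.projs_closed)

text \<open>Under \<open>emb\<close> the proposed generator becomes \<open>(\<gamma> s, s)\<close>,
  so injectivity reduces both laws to those of \<open>\<gamma>\<close> and a trivial equation in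
  \<open>S\<close>.\<close>

lemma strong_premorphism_semidirect: "strong_premorphism S semi (\<lambda>s. (rplus T (\<gamma> s), s))"
proof -
  interpret W: restriction_monoid semi by (rule restriction_monoid_semidirect)
  have c: "(rplus T (\<gamma> s), s) \<in> carrier semi" if "s \<in> carrier S" for s
    using that by (auto simp: T.projs_idem)
  have eq: "x = y" if "emb x = emb y" "x \<in> carrier semi" "y \<in> carrier semi" for x y
    using inj_on_emb that by (auto dest: inj_onD)
  have m: "emb (x \<otimes>\<^bsub>semi\<^esub> y) = emb x \<otimes>\<^bsub>TS\<^esub> emb y" if "x \<in> carrier semi" "y \<in> carrier semi" for x y
    using emb_mult that by (metis surj_pair)
  have g: "emb (rplus T (\<gamma> s), s) = (\<gamma> s, s)" if "s \<in> carrier S" for s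
    using that by (simp add: T.rplus_left)
  show ?thesis
  proof (unfold_locales, goal_cases)
    \<comment> \<open>Cases 3 and 4 are the laws \<open>gamma_plus\<close> and
      \<open>gamma_star\<close>.\<close>
    case (3 s t)
    show ?case
      by (rule eq; (intro W.m_closed W.rplus_closed c S.m_closed 3)?)
        (use 3 in \<open>simp add: m c g emb_rplus gamma_plus del: semidirect_simps emb_simp\<close>)
  next
    case (4 s t)
    show ?case
      by (rule eq; (intro W.m_closed W.rstar_closed c S.m_closed 4)?)
        (use 4 in \<open>simp add: m c g emb_rstar gamma_star del: semidirect_simps emb_simp\<close>)
  qed (use c in \<open>auto simp: T.rplus_one\<close>)
qed

end

section \<open>The generalized prefix expansion\<close>

lemma Spr_carrier:
  "(A, s) \<in> carrier (Spr S) \<longleftrightarrow> s \<in> carrier S \<and> A \<subseteq> carrier S \<and> finite A \<and> s \<in> A \<and>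
     inv_plus S s \<in> A \<and> (\<forall>a\<in>A. inv_plus S a = inv_plus S s)"
  by (auto simp: Spr_def)

lemma Spr_carrierD:
  assumes "(A, s) \<in> carrier (Spr S)"
  shows "s \<in> carrier S" "A \<subseteq> carrier S" "finite A" "s \<in> A" "inv_plus S s \<in> A"
    "\<And>a. a \<in> A \<Longrightarrow> inv_plus S a = inv_plus S s"
  using assms unfolding Spr_carrier by blast+

lemma Spr_simps [simp]:
  "(A, s) \<otimes>\<^bsub>Spr S\<^esub> (B, t) =
     (mult S (inv_plus S (s \<otimes>\<^bsub>S\<^esub> t)) ` A \<union> mult S s ` B, s \<otimes>\<^bsub>S\<^esub> t)"
  "\<one>\<^bsub>Spr S\<^esub> = ({\<one>\<^bsub>S\<^esub>}, \<one>\<^bsub>S\<^esub>)"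
  by (auto simp: Spr_def)

context inverse_monoid
begin

sublocale R: restriction_monoid "inv_restriction S"
  rewrites "carrier (inv_restriction S) = carrier S" and "mult (inv_restriction S) = mult S"
    and "one (inv_restriction S) = one S" and "rstar (inv_restriction S) = inv_star S"
    and "rplus (inv_restriction S) = inv_plus S"
  by (rule restriction_monoid_inv_restriction) simp_all

lemma projs_inv_restriction: "projs (inv_restriction S) = idems S"
  by (auto simp: projs_def inv_plus_of_idem idems_closed) (metis inv_plus_idem)

lemma inv_plus_left_left: "x \<in> carrier S \<Longrightarrow> y \<in> carrier S \<Longrightarrow> inv_plus S x \<otimes> (x \<otimes> y) = x \<otimes> y"
  by (simp add: m_assoc[symmetric] inv_plus_left)

lemma inv_plus_mult_absorb:
  "x \<in> carrier S \<Longrightarrow> y \<in> carrier S \<Longrightarrow> inv_plus S (x \<otimes> y) \<otimes> inv_plus S x = inv_plus S (x \<otimes> y)"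
  using R.rplus_mult_absorb[of x y] idems_comm[of "inv_plus S (x \<otimes> y)" "inv_plus S x"] by simp

lemma image_mult_mult:
  "x \<in> carrier S \<Longrightarrow> y \<in> carrier S \<Longrightarrow> A \<subseteq> carrier S \<Longrightarrow>
    mult S x ` mult S y ` A = mult S (x \<otimes> y) ` A"
  by (auto simp: image_image m_assoc subset_eq intro!: image_cong)

text \<open>Elements of \<open>B\<close> have the same \<open>inv_plus\<close> as \<open>t\<close>,
  so by the congruence condition \<open>sb\<close> and \<open>st\<close> agree there too. On the
  \<open>A\<close> side, \<open>inv_plus S (s \<otimes> t)\<close> lies below the common value
  \<open>inv_plus S s\<close>.\<close>

lemma Spr_mult_closed:
  assumes "x \<in> carrier (Spr S)" "y \<in> carrier (Spr S)"
  shows "x \<otimes>\<^bsub>Spr S\<^esub> y \<in> carrier (Spr S)"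
proof -
  obtain A s B t where xy: "x = (A, s)" "y = (B, t)" by (metis surj_pair)
  note s = Spr_carrierD[OF assms(1)[unfolded xy]]
    and t = Spr_carrierD[OF assms(2)[unfolded xy]]
  have "inv_plus S (s \<otimes> t) \<in> mult S (inv_plus S (s \<otimes> t)) ` A"
    by (rule image_eqI[of _ _ "inv_plus S s"]) (use s(1-5) t(1) in \<open>simp_all add: inv_plus_mult_absorb\<close>)
  moreover have "inv_plus S (inv_plus S (s \<otimes> t) \<otimes> a) = inv_plus S (s \<otimes> t)" if "a \<in> A" for a
    using that s(1-5) s(6)[OF that] t(1) by (simp add: inv_plus_mult inv_plus_mult_absorb subset_eq)
  moreover have "inv_plus S (s \<otimes> b) = inv_plus S (s \<otimes> t)" if "b \<in> B" for b
    using R.rplus_mult_rplus[of s b] R.rplus_mult_rplus[of s t] that s(1) t(1,2) t(6)[OF that]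
    by (simp add: subset_eq)
  ultimately have "\<forall>a\<in>mult S (inv_plus S (s \<otimes> t)) ` A \<union> mult S s ` B. inv_plus S a = inv_plus S (s \<otimes> t)"
    "inv_plus S (s \<otimes> t) \<in> mult S (inv_plus S (s \<otimes> t)) ` A"
    by blast+
  then show ?thesis
    using s(1-5) t(1-5) unfolding xy Spr_simps Spr_carrier by blast
qed

text \<open>Comparing the three images, those of \<open>A\<close> agree because
  \<open>inv_plus S (stu)\<close> is below \<open>inv_plus S (st)\<close>, those of \<open>B\<close>
  by the ample identity, and those of \<open>C\<close> by associativity.\<close>

lemma Spr_assoc:
  assumes "x \<in> carrier (Spr S)" "y \<in> carrier (Spr S)" "z \<in> carrier (Spr S)"
  shows "x \<otimes>\<^bsub>Spr S\<^esub> y \<otimes>\<^bsub>Spr S\<^esub> z = x \<otimes>\<^bsub>Spr S\<^esub> (y \<otimes>\<^bsub>Spr S\<^esub> z)"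
proof -
  obtain A s B t C u where xyz: "x = (A, s)" "y = (B, t)" "z = (C, u)"
    by (metis surj_pair)
  have c: "s \<in> carrier S" "t \<in> carrier S" "u \<in> carrier S"
    "A \<subseteq> carrier S" "B \<subseteq> carrier S" "C \<subseteq> carrier S"
    using assms unfolding xyz Spr_carrier by simp_all
  have "inv_plus S (s \<otimes> t \<otimes> u) \<otimes> inv_plus S (s \<otimes> t) = inv_plus S (s \<otimes> t \<otimes> u)"
    using c by (simp add: inv_plus_mult_absorb)
  moreover have "inv_plus S (s \<otimes> t \<otimes> u) \<otimes> s = s \<otimes> inv_plus S (t \<otimes> u)"
    using c by (simp add: inv_plus_ample m_assoc)
  ultimately show ?thesis
    using c unfolding xyz by (simp add: image_Un image_mult_mult Un_assoc) (simp add: m_assoc)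
qed

lemma image_inv_plus:
  assumes "A \<subseteq> carrier S" "\<forall>a\<in>A. inv_plus S a = e"
  shows "mult S e ` A = A"
proof -
  have "e \<otimes> a = a" if "a \<in> A" for a
    using assms inv_plus_left[of a] that by auto
  then show ?thesis by force
qed

lemma Spr_image:
  assumes "(A, s) \<in> carrier (Spr S)"
  shows "mult S (inv_plus S s) ` A = A"
  using image_inv_plus Spr_carrierD(2,6)[OF assms] by blast

lemma monoid_Spr: "monoid (Spr S)"
proof
  fix x assume x: "x \<in> carrier (Spr S)"
  obtain A s where xs: "x = (A, s)" by (metis surj_pair)
  note A = Spr_carrierD[OF x[unfolded xs]]
  have A1: "mult S \<one> ` A = A" using A(2) by (auto simp: subset_eq image_iff)
  have As: "mult S (inv_plus S s) ` A = A"
    using x xs by (simp add: Spr_image)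
  show "\<one>\<^bsub>Spr S\<^esub> \<otimes>\<^bsub>Spr S\<^esub> x = x" "x \<otimes>\<^bsub>Spr S\<^esub> \<one>\<^bsub>Spr S\<^esub> = x"
    using A(1,4,5) unfolding xs by (auto simp: A1 As)
next
  show "\<one>\<^bsub>Spr S\<^esub> \<in> carrier (Spr S)"
    by (simp add: Spr_carrier inv_plus_of_idem idems_def)
qed (auto simp: Spr_assoc simp del: Spr_simps intro: Spr_mult_closed)

text \<open>Idempotency is a condition on the second component alone: when \<open>e\<close> is
  idempotent, every element of \<open>A\<close> has \<open>inv_plus\<close> equal to
  \<open>e\<close> and is hence fixed by \<open>e\<close>.\<close>

lemma idems_Spr:
  "(A, e) \<in> idems (Spr S) \<longleftrightarrow> (A, e) \<in> carrier (Spr S) \<and> e \<in> idems S"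
proof
  assume "(A, e) \<in> carrier (Spr S) \<and> e \<in> idems S"
  moreover from this have "mult S e ` A = A"
    using Spr_carrierD(2,6)[of A e S] image_inv_plus[of A e] by (metis inv_plus_of_idem)
  ultimately show "(A, e) \<in> idems (Spr S)"
    by (auto simp: idems_def inv_plus_of_idem)
next
  assume "(A, e) \<in> idems (Spr S)"
  then show "(A, e) \<in> carrier (Spr S) \<and> e \<in> idems S"
    using Spr_carrierD(1)[of A e S] by (simp add: idems_def)
qed

lemma idems_SprD:
  assumes "(A, e) \<in> idems (Spr S)"
  shows "e \<in> idems S" "e \<in> carrier S" "A \<subseteq> carrier S" "finite A" "e \<in> A"
    "\<And>a. a \<in> A \<Longrightarrow> inv_plus S a = e" "mult S e ` A = A"
proof -
  have A: "(A, e) \<in> carrier (Spr S)" and e: "e \<in> idems S"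
    using assms by (simp_all add: idems_Spr)
  note s = Spr_carrierD[OF A, unfolded inv_plus_of_idem[OF e]]
  show "e \<in> idems S" "e \<in> carrier S" "A \<subseteq> carrier S" "finite A" "e \<in> A"
    "\<And>a. a \<in> A \<Longrightarrow> inv_plus S a = e" "mult S e ` A = A"
    using s e image_inv_plus[of A e] by blast+
qed

text \<open>From \<open>fB = B\<close> follows \<open>eB = efB\<close>, which makes the asymmetric
  multiplication symmetric; commutation of idempotents can then be read off.\<close>

lemma idems_Spr_mult:
  assumes "(A, e) \<in> idems (Spr S)" "(B, f) \<in> idems (Spr S)"
  shows "(A, e) \<otimes>\<^bsub>Spr S\<^esub> (B, f) = (mult S (e \<otimes> f) ` (A \<union> B), e \<otimes> f)"
proof -
  note A = idems_SprD(1-5,7)[OF assms(1)] and B = idems_SprD(1-5,7)[OF assms(2)]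
  have "mult S e ` B = mult S (e \<otimes> f) ` B"
    using image_mult_mult[OF A(2) B(2,3)] B(6) by simp
  then show ?thesis
    using A B by (simp add: image_Un inv_plus_of_idem idems_mult)
qed

lemma Spr_iinv_closed:
  assumes "(A, s) \<in> carrier (Spr S)"
  shows "(mult S (iinv S s) ` A, iinv S s) \<in> carrier (Spr S)"
proof -
  note s = Spr_carrierD(1-5)[OF assms]
  \<comment> \<open>The two distinguished elements of \<open>A\<close> exchange roles:
    \<open>s s^-1\<close> is sent to \<open>s^-1\<close>, and \<open>s\<close> to
    \<open>s^-1 s\<close>.\<close>
  have "iinv S s \<in> mult S (iinv S s) ` A"
    by (rule image_eqI[of _ _ "inv_plus S s"]) (use s in \<open>simp_all add: inv_plus_def\<close>)
  moreover have "inv_plus S (iinv S s) \<in> mult S (iinv S s) ` A"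
    by (rule image_eqI[of _ _ "s"]) (use s in \<open>simp_all add: inv_plus_def\<close>)
  moreover have "inv_plus S (iinv S s \<otimes> a) = inv_plus S (iinv S s)" if "a \<in> A" for a
    using R.rplus_mult_rplus[of "iinv S s" a] that s Spr_carrierD(6)[OF assms that]
    by (simp add: subset_eq) (simp add: inv_plus_def)
  ultimately show ?thesis
    using s unfolding Spr_carrier by blast
qed

lemma Spr_mult_iinv:
  assumes "(A, s) \<in> carrier (Spr S)"
  shows "(A, s) \<otimes>\<^bsub>Spr S\<^esub> (mult S (iinv S s) ` A, iinv S s) = (A, inv_plus S s)"
  using Spr_carrierD(1-2)[OF assms] Spr_image[OF assms]
  by (simp add: image_mult_mult inv_plus_of_idem flip: inv_plus_def[of S s])

lemma Spr_iinv_mult: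
  assumes "(A, s) \<in> carrier (Spr S)"
  shows "(mult S (iinv S s) ` A, iinv S s) \<otimes>\<^bsub>Spr S\<^esub> (A, s) =
    (mult S (iinv S s) ` A, inv_star S s)"
proof -
  note s = Spr_carrierD(1-2)[OF assms]
  have "inv_star S s \<otimes> iinv S s = iinv S s"
    using s by (simp add: inv_star_def m_assoc)
  with s show ?thesis
    by (simp add: image_mult_mult inv_plus_of_idem flip: inv_star_def[of S s])
qed

lemma Spr_regular:
  assumes A: "(A, s) \<in> carrier (Spr S)"
  defines "y \<equiv> (mult S (iinv S s) ` A, iinv S s)"
  shows "(A, s) \<otimes>\<^bsub>Spr S\<^esub> y \<otimes>\<^bsub>Spr S\<^esub> (A, s) = (A, s)" "y \<otimes>\<^bsub>Spr S\<^esub> (A, s) \<otimes>\<^bsub>Spr S\<^esub> y = y"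
proof -
  note s = Spr_carrierD(1-2)[OF A]
  show "(A, s) \<otimes>\<^bsub>Spr S\<^esub> y \<otimes>\<^bsub>Spr S\<^esub> (A, s) = (A, s)"
    using s Spr_image[OF A] unfolding y_def Spr_mult_iinv[OF A]
    by (simp add: inv_plus_left)
  have "inv_star S s \<otimes> iinv S s = iinv S s" "inv_plus S (iinv S s) \<otimes> iinv S s = iinv S s"
    using s by (simp_all add: inv_star_def inv_plus_def m_assoc)
  with s show "y \<otimes>\<^bsub>Spr S\<^esub> (A, s) \<otimes>\<^bsub>Spr S\<^esub> y = y"
    unfolding y_def Spr_iinv_mult[OF A] by (simp add: image_mult_mult)
qed

lemma inverse_monoid_Spr: "inverse_monoid (Spr S)"
proof (rule inverse_monoidI[OF monoid_Spr])
  fix x assume "x \<in> carrier (Spr S)"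
  then show "\<exists>y\<in>carrier (Spr S). x \<otimes>\<^bsub>Spr S\<^esub> y \<otimes>\<^bsub>Spr S\<^esub> x = x \<and> y \<otimes>\<^bsub>Spr S\<^esub> x \<otimes>\<^bsub>Spr S\<^esub> y = y"
    using Spr_iinv_closed Spr_regular by (metis surj_pair)
next
  fix x y assume "x \<in> idems (Spr S)" "y \<in> idems (Spr S)"
  then show "x \<otimes>\<^bsub>Spr S\<^esub> y = y \<otimes>\<^bsub>Spr S\<^esub> x"
    by (cases x; cases y)
      (simp add: idems_Spr_mult idems_comm[OF idems_SprD(1) idems_SprD(1)] Un_commute del: Spr_simps)
qed

interpretation Spr: inverse_monoid "Spr S"
  by (rule inverse_monoid_Spr)

lemma iinv_Spr:
  assumes A: "(A, s) \<in> carrier (Spr S)"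
  shows "iinv (Spr S) (A, s) = (mult S (iinv S s) ` A, iinv S s)"
  using Spr.iinv_eqI[OF A Spr_iinv_closed[OF A]] Spr_regular[OF A]
  unfolding Spr.m_assoc[OF A Spr_iinv_closed[OF A] A]
    Spr.m_assoc[OF Spr_iinv_closed[OF A] A Spr_iinv_closed[OF A]]
  by blast

lemma inv_plus_Spr: "(A, s) \<in> carrier (Spr S) \<Longrightarrow> inv_plus (Spr S) (A, s) = (A, inv_plus S s)"
  unfolding inv_plus_def[of "Spr S"] by (simp only: iinv_Spr Spr_mult_iinv)

lemma inv_star_Spr:
  "(A, s) \<in> carrier (Spr S) \<Longrightarrow> inv_star (Spr S) (A, s) = (mult S (iinv S s) ` A, inv_star S s)"
  unfolding inv_star_def[of "Spr S"] by (simp only: iinv_Spr Spr_iinv_mult)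

section \<open>The generators of the expansion\<close>

lemma pr_gen_closed: "s \<in> carrier S \<Longrightarrow> pr_gen S s \<in> carrier (Spr S)"
  by (auto simp: pr_gen_def Spr_carrier inv_plus_of_idem)

lemma inv_plus_pr_gen:
  "s \<in> carrier S \<Longrightarrow> inv_plus (Spr S) (pr_gen S s) = ({s, inv_plus S s}, inv_plus S s)"
  using pr_gen_closed[of s] by (simp add: pr_gen_def inv_plus_Spr)

text \<open>All products occurring in the two laws have the set
  \<open>{st, (st)(st)^-1, s t t^-1}\<close>; the ample identity
  \<open>(st)(st)^-1 s = s t t^-1\<close> supplies the coincidences.\<close>

lemma strong_premorphism_pr_gen: "strong_premorphism S (inv_restriction (Spr S)) (pr_gen S)"
proof -
  interpret P: restriction_monoid "inv_restriction (Spr S)"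
    by (rule Spr.restriction_monoid_inv_restriction)
  show ?thesis
  proof (unfold_locales, goal_cases)
    case (3 s t)
    have "inv_plus S (s \<otimes> t) \<otimes> s = s \<otimes> inv_plus S t"
      using 3 by (simp add: inv_plus_ample)
    with 3 show ?case
      by (simp add: inv_plus_pr_gen) (auto simp: pr_gen_def inv_plus_left inv_plus_left_left
          inv_plus_mult_absorb R.rplus_mult_absorb m_assoc[symmetric] inv_plus_mult)
  next
    case (4 s t)
    have "mult S (s \<otimes> t) ` {iinv S t, inv_star S t} = {s \<otimes> inv_plus S t, s \<otimes> t}"
      using 4 by (simp add: m_assoc inv_star_right) (simp add: inv_plus_def)
    moreover have "mult S (iinv S t) ` {t, inv_plus S t} = {iinv S t, inv_star S t}"
      using 4 by (auto simp: inv_star_def inv_plus_def)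
    moreover have "inv_star (Spr S) (pr_gen S t) = (mult S (iinv S t) ` {t, inv_plus S t}, inv_star S t)"
      using 4 pr_gen_closed[of t] by (simp add: inv_star_Spr pr_gen_def)
    moreover have "s \<otimes> t \<otimes> inv_star S t = s \<otimes> t"
      using 4 by (simp add: m_assoc inv_star_right)
    moreover have "inv_plus S (s \<otimes> t) \<otimes> s = s \<otimes> inv_plus S t"
      using 4 by (simp add: inv_plus_ample)
    ultimately show ?case
      using 4 by (auto simp: pr_gen_def inv_plus_left idems_idem inv_plus_mult_absorb)
  qed (auto simp: pr_gen_closed, auto simp: pr_gen_def inv_plus_of_idem idems_def)
qed

lemma EprS_eq: "EprS S = semidirect S (inv_restriction (Spr S)) (pr_gen S)"
  by (simp add: EprS_def semidirect_def idem_le_def Spr.projs_inv_restriction)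

end

section \<open>Restriction monoids given by generators and relations\<close>

lemma rterms_simps [simp]:
  "Gen x \<in> rterms X \<longleftrightarrow> x \<in> X" "One \<in> rterms X"
  "Mul u v \<in> rterms X \<longleftrightarrow> u \<in> rterms X \<and> v \<in> rterms X"
  "Star u \<in> rterms X \<longleftrightarrow> u \<in> rterms X" "Plus u \<in> rterms X \<longleftrightarrow> u \<in> rterms X"
  by (auto simp: rterms_def)

lemma rcong_rterms: "(u, v) \<in> rcong X R \<Longrightarrow> u \<in> rterms X \<and> v \<in> rterms X"
  by (induction rule: rcong.induct) auto

lemma equiv_rcong: "equiv (rterms X) (rcong X R)"
  by (auto simp: equiv_def refl_on_def sym_def trans_def dest: rcong_rterms
      intro: rcong.refl rcong.sym rcong.trans)

abbreviation rclass :: "'x set \<Rightarrow> ('x rterm \<times> 'x rterm) set \<Rightarrow> 'x rterm \<Rightarrow> 'x rterm set" where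
  "rclass X R u \<equiv> rcong X R `` {u}"

lemma rclass_eq: "(u, v) \<in> rcong X R \<Longrightarrow> rclass X R u = rclass X R v"
  by (rule equiv_class_eq[OF equiv_rcong])

lemma presented_carrier: "carrier (presented X R) = rclass X R ` rterms X"
  by (auto simp: presented_def quotient_def)

lemma presented_one [simp]: "\<one>\<^bsub>presented X R\<^esub> = rclass X R One"
  by (simp add: presented_def)

lemma presented_mult [simp]:
  "u \<in> rterms X \<Longrightarrow> v \<in> rterms X \<Longrightarrow>
    rclass X R u \<otimes>\<^bsub>presented X R\<^esub> rclass X R v = rclass X R (Mul u v)"
  unfolding presented_def
  by (simp, rule UN_equiv_class2[OF equiv_rcong equiv_rcong])
    (auto intro!: congruent2I equiv_rcong rclass_eq rcong.Mul rcong.refl)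

lemma presented_rstar [simp]:
  "u \<in> rterms X \<Longrightarrow> rstar (presented X R) (rclass X R u) = rclass X R (Star u)"
  unfolding presented_def
  by (simp, rule UN_equiv_class[OF equiv_rcong]) (auto intro!: congruentI rclass_eq rcong.Star)

lemma presented_rplus [simp]:
  "u \<in> rterms X \<Longrightarrow> rplus (presented X R) (rclass X R u) = rclass X R (Plus u)"
  unfolding presented_def
  by (simp, rule UN_equiv_class[OF equiv_rcong]) (auto intro!: congruentI rclass_eq rcong.Plus)

lemma restriction_monoid_presented: "restriction_monoid (presented X R)"
  by unfold_locales
    (auto simp: presented_carrier rcong.assoc[THEN rclass_eq] rcong.one_left[THEN rclass_eq]
      rcong.one_right[THEN rclass_eq] rcong.plus_left[THEN rclass_eq]
      rcong.plus_comm[THEN rclass_eq] rcong.plus_mult[THEN rclass_eq]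
      rcong.plus_ample[THEN rclass_eq, symmetric] rcong.star_right[THEN rclass_eq]
      rcong.star_comm[THEN rclass_eq] rcong.star_mult[THEN rclass_eq]
      rcong.star_ample[THEN rclass_eq, symmetric] rcong.star_plus[THEN rclass_eq]
      rcong.plus_star[THEN rclass_eq] simp del: Image_singleton_iff)

section \<open>Evaluation of terms and extension of maps from the generators\<close>

primrec rterm_eval ::
  "('a, 'b) restriction_monoid_scheme \<Rightarrow> ('x \<Rightarrow> 'a) \<Rightarrow> 'x rterm \<Rightarrow> 'a" where
  "rterm_eval T h (Gen x) = h x"
| "rterm_eval T h One = \<one>\<^bsub>T\<^esub>"
| "rterm_eval T h (Mul u v) = rterm_eval T h u \<otimes>\<^bsub>T\<^esub> rterm_eval T h v"
| "rterm_eval T h (Star u) = rstar T (rterm_eval T h u)"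
| "rterm_eval T h (Plus u) = rplus T (rterm_eval T h u)"

text \<open>Evaluation is constant on congruence classes when it respects the relations, so the
  image of a class is then a singleton.\<close>

definition presented_lift ::
  "('a, 'b) restriction_monoid_scheme \<Rightarrow> ('x \<Rightarrow> 'a) \<Rightarrow> 'x rterm set \<Rightarrow> 'a" where
  "presented_lift T h C = the_elem (rterm_eval T h ` C)"

context restriction_monoid
begin

lemma rterm_eval_closed:
  assumes "h \<in> X \<rightarrow> carrier T"
  shows "u \<in> rterms X \<Longrightarrow> rterm_eval T h u \<in> carrier T"
  using assms by (induction u) auto

lemma rterm_eval_rcong:
  assumes h: "h \<in> X \<rightarrow> carrier T"
    and R: "\<And>u v. (u, v) \<in> R \<Longrightarrow> u \<in> rterms X \<Longrightarrow> v \<in> rterms X \<Longrightarrow>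
      rterm_eval T h u = rterm_eval T h v"
  shows "(u, v) \<in> rcong X R \<Longrightarrow> rterm_eval T h u = rterm_eval T h v"
proof (induction rule: rcong.induct)
  case (plus_comm u v)
  then show ?case using rterm_eval_closed[OF h] rplus_comm by simp
next
  case (star_comm u v)
  then show ?case using rterm_eval_closed[OF h] rstar_comm by simp
qed (simp_all add: R rterm_eval_closed[OF h] m_assoc rplus_left rplus_mult rplus_ample[symmetric]
    rstar_right rstar_mult rstar_ample[symmetric] rstar_rplus rplus_rstar)

context
  fixes X :: "'x set" and R h
  assumes h: "h \<in> X \<rightarrow> carrier T"
    and R: "\<And>u v. (u, v) \<in> R \<Longrightarrow> u \<in> rterms X \<Longrightarrow> v \<in> rterms X \<Longrightarrow>
      rterm_eval T h u = rterm_eval T h v"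
begin

lemma presented_lift_rclass:
  assumes "u \<in> rterms X"
  shows "presented_lift T h (rclass X R u) = rterm_eval T h u"
proof -
  have "rterm_eval T h v = rterm_eval T h u" if "v \<in> rclass X R u" for v
    using rterm_eval_rcong[OF h R] that by (metis Image_singleton_iff)
  then have "rterm_eval T h ` rclass X R u = {rterm_eval T h u}"
    using rcong.refl[OF assms] by blast
  then show ?thesis
    by (simp add: presented_lift_def)
qed

lemma presented_lift_hom: "presented_lift T h \<in> restriction_hom (presented X R) T"
  by (auto simp: restriction_hom_def presented_carrier presented_lift_rclass rterm_eval_closed[OF h])

end

end

section \<open>Strong premorphisms of inverse monoids\<close>

context strong_premorphism
begin

abbreviation gplus :: "'a \<Rightarrow> 'c" where "gplus s \<equiv> rplus T (\<gamma> s)"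

text \<open>The carrier is cut down to the projections because \<open>finprod\<close> requires
  commutativity, which \<open>T\<close> as a whole may lack.\<close>

definition plus_prod :: "'a set \<Rightarrow> 'c" where
  "plus_prod A = finprod (T\<lparr>carrier := projs T\<rparr>) gplus A"

lemma comm_monoid_projs: "comm_monoid (T\<lparr>carrier := projs T\<rparr>)"
  by unfold_locales (auto simp: T.m_assoc T.projs_closed intro: T.projs_comm)

lemma plus_prod_empty [simp]: "plus_prod {} = \<one>\<^bsub>T\<^esub>"
  unfolding plus_prod_def using comm_monoid.finprod_empty[OF comm_monoid_projs] by simp

lemma plus_prod_in_projs: "A \<subseteq> carrier S \<Longrightarrow> plus_prod A \<in> projs T"
  unfolding plus_prod_def using comm_monoid.finprod_closed[OF comm_monoid_projs, of gplus A] by auto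

lemma plus_prod_closed: "A \<subseteq> carrier S \<Longrightarrow> plus_prod A \<in> carrier T"
  by (rule T.projs_closed[OF plus_prod_in_projs])

text \<open>When \<open>a\<close> already belongs to \<open>A\<close>, the repeated factor
  disappears because projections are idempotent.\<close>

lemma plus_prod_insert:
  assumes A: "finite A" "A \<subseteq> carrier S" and a: "a \<in> carrier S"
  shows "plus_prod (insert a A) = gplus a \<otimes>\<^bsub>T\<^esub> plus_prod A"
proof -
  have *: "plus_prod (insert a B) = gplus a \<otimes>\<^bsub>T\<^esub> plus_prod B" if "B \<subseteq> A" "a \<notin> B" for B
    unfolding plus_prod_def using that A a
    by (subst comm_monoid.finprod_insert[OF comm_monoid_projs]) (auto intro: finite_subset)
  show ?thesis
  proof (cases "a \<in> A")
    case True
    then have "plus_prod A = gplus a \<otimes>\<^bsub>T\<^esub> plus_prod (A - {a})"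
      using *[of "A - {a}"] by (auto simp: insert_absorb)
    moreover have "plus_prod (A - {a}) \<in> carrier T"
      using A by (intro plus_prod_closed) auto
    ultimately show ?thesis
      using True a by (simp add: insert_absorb T.projs_idem_left)
  qed (use * in auto)
qed

lemma plus_prod_singleton: "a \<in> carrier S \<Longrightarrow> plus_prod {a} = gplus a"
  by (simp add: plus_prod_insert)

lemma plus_prod_union:
  assumes "finite A" "A \<subseteq> carrier S" "finite B" "B \<subseteq> carrier S"
  shows "plus_prod (A \<union> B) = plus_prod A \<otimes>\<^bsub>T\<^esub> plus_prod B"
  using assms(1,2) by induction (simp_all add: plus_prod_insert plus_prod_closed T.m_assoc assms)

lemma plus_prod_absorb:
  assumes "finite A" "A \<subseteq> carrier S" "a \<in> A"
  shows "gplus a \<otimes>\<^bsub>T\<^esub> plus_prod A = plus_prod A"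
  using plus_prod_insert[of A a] assms by (auto simp: insert_absorb)

text \<open>For one factor, the ample identity and \<open>gamma_plus\<close> leave
  \<open>gplus s\<close> and \<open>gplus (s \<otimes> b)\<close> in front of
  \<open>\<gamma> s\<close>, and \<open>\<gamma> s\<close> absorbs \<open>gplus s\<close>. This
  mirrors the translation of sets by \<open>s\<close> in \<open>Spr S\<close>.\<close>

lemma gamma_plus_prod:
  assumes s: "s \<in> carrier S" and "finite B" "B \<subseteq> carrier S"
  shows "\<gamma> s \<otimes>\<^bsub>T\<^esub> plus_prod B = plus_prod (mult S s ` B) \<otimes>\<^bsub>T\<^esub> \<gamma> s"
  using assms(2,3)
proof induction
  case (insert b B)
  have B: "b \<in> carrier S" "B \<subseteq> carrier S" "mult S s ` B \<subseteq> carrier S" using insert s by auto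
  note c = plus_prod_closed[OF B(2)] plus_prod_closed[OF B(3)]
  have "\<gamma> s \<otimes>\<^bsub>T\<^esub> plus_prod (insert b B) = \<gamma> s \<otimes>\<^bsub>T\<^esub> gplus b \<otimes>\<^bsub>T\<^esub> plus_prod B"
    using insert B s c by (simp add: plus_prod_insert T.m_assoc)
  also have "\<gamma> s \<otimes>\<^bsub>T\<^esub> gplus b = gplus s \<otimes>\<^bsub>T\<^esub> gplus (s \<otimes> b) \<otimes>\<^bsub>T\<^esub> \<gamma> s"
    using s B by (subst T.rplus_ample) (auto simp: gamma_plus T.rplus_mult)
  also have "\<dots> = gplus (s \<otimes> b) \<otimes>\<^bsub>T\<^esub> \<gamma> s"
    using s B T.projs_comm[of "gplus s" "gplus (s \<otimes> b)"] by (simp add: T.m_assoc T.rplus_left)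
  also have "\<dots> \<otimes>\<^bsub>T\<^esub> plus_prod B = gplus (s \<otimes> b) \<otimes>\<^bsub>T\<^esub> plus_prod (mult S s ` B) \<otimes>\<^bsub>T\<^esub> \<gamma> s"
    using s B c insert by (simp add: T.m_assoc)
  also have "\<dots> = plus_prod (mult S s ` insert b B) \<otimes>\<^bsub>T\<^esub> \<gamma> s"
    using s B insert by (simp add: plus_prod_insert)
  finally show ?case .
qed (use s in simp)

end

section \<open>Projections of generators over an inverse monoid\<close>

locale inverse_strong_premorphism = strong_premorphism + S: inverse_monoid S
begin

interpretation Spr: inverse_monoid "Spr S"
  by (rule S.inverse_monoid_Spr)

lemma gamma_idem: "e \<in> idems S \<Longrightarrow> \<gamma> e \<otimes>\<^bsub>T\<^esub> \<gamma> e = \<gamma> e"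
  by (simp add: S.idems_closed S.idems_idem gamma_plus T.rplus_left)

text \<open>Both sides are the projection of \<open>\<gamma> e\<close> times
  \<open>\<gamma> s\<close>: one is computed by \<open>gamma_plus\<close>, the other by
  \<open>idempotent_mult_proj\<close>.\<close>

lemma gplus_idem_mult:
  assumes e: "e \<in> idems S" and s: "s \<in> carrier S"
  shows "gplus e \<otimes>\<^bsub>T\<^esub> gplus (e \<otimes> s) = gplus e \<otimes>\<^bsub>T\<^esub> gplus s"
proof -
  note c = S.idems_closed[OF e]
  have "gplus e \<otimes>\<^bsub>T\<^esub> gplus (e \<otimes> s) = rplus T (\<gamma> e \<otimes>\<^bsub>T\<^esub> gplus s)"
    using c s by (simp add: T.rplus_mult_rplus gamma_plus T.rplus_mult)
  also have "\<dots> = gplus e \<otimes>\<^bsub>T\<^esub> gplus s"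
    by (rule T.idempotent_mult_proj) (use c s gamma_idem[OF e] in auto)
  finally show ?thesis .
qed

text \<open>With \<open>f = s s^-1\<close> we have \<open>fs = s\<close>, so the two laws applied to
  \<open>\<gamma> f\<close> times \<open>\<gamma> s\<close> show that \<open>gplus f\<close> fixes
  \<open>\<gamma> s\<close>.\<close>

lemma gplus_inv_plus:
  assumes s: "s \<in> carrier S"
  shows "gplus (inv_plus S s) \<otimes>\<^bsub>T\<^esub> gplus s = gplus s"
proof -
  have "gplus (inv_plus S s) \<otimes>\<^bsub>T\<^esub> \<gamma> s = \<gamma> s"
    using gamma_plus[of "inv_plus S s" s] gamma_star[of "inv_plus S s" s] s
    by (simp add: S.inv_plus_left T.rstar_right)
  then show ?thesis
    using s T.rplus_mult[of "\<gamma> (inv_plus S s)" "\<gamma> s"] by simp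
qed

lemma rstar_inv_star:
  assumes s: "s \<in> carrier S"
  shows "rstar T (\<gamma> s) \<otimes>\<^bsub>T\<^esub> rstar T (\<gamma> (inv_star S s)) = rstar T (\<gamma> s)"
proof -
  have "\<gamma> s \<otimes>\<^bsub>T\<^esub> rstar T (\<gamma> (inv_star S s)) = \<gamma> s"
    using gamma_plus[of s "inv_star S s"] gamma_star[of s "inv_star S s"] s
    by (simp add: S.inv_star_right T.rplus_left)
  then show ?thesis
    using s T.rstar_mult[of "\<gamma> s" "\<gamma> (inv_star S s)"] by simp
qed

text \<open>Applying \<open>gplus_idem_mult\<close> to \<open>ef\<close> and \<open>e\<close>, where
  \<open>efe = ef\<close>, puts \<open>gplus (e \<otimes> f)\<close> below \<open>gplus e\<close>.
  Applying it to \<open>e\<close> and \<open>f\<close> then gives the product.\<close>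

lemma gplus_mult_idems:
  assumes e: "e \<in> idems S" and f: "f \<in> idems S"
  shows "gplus (e \<otimes> f) = gplus e \<otimes>\<^bsub>T\<^esub> gplus f"
proof -
  note c = S.idems_closed[OF e] S.idems_closed[OF f]
  have *: "gplus (e \<otimes> f) = gplus (e \<otimes> f) \<otimes>\<^bsub>T\<^esub> gplus e"
    using gplus_idem_mult[OF S.idems_mult[OF e f], of e] c S.idems_comm[OF e f]
    by (simp add: S.m_assoc S.idems_idem[OF e] S.idems_idem_left[OF f] T.projs_idem)
  then show ?thesis
    using gplus_idem_mult[OF e c(2)] T.projs_comm[of "gplus (e \<otimes> f)" "gplus e"] c by simp
qed

text \<open>The two laws evaluate \<open>\<gamma> (u^-1)\<close> times \<open>\<gamma> u\<close> in
  two ways, which is \<open>eq\<close>. Taking \<open>rplus\<close> of both sides,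
  \<open>gplus d\<close> is absorbed on the left; on the right it equals
  \<open>rstar T (\<gamma> d)\<close>, as \<open>\<gamma> d\<close> is idempotent, and is absorbed
  by \<open>rstar T (\<gamma> u)\<close>.\<close>

lemma gplus_iinv:
  assumes u: "u \<in> carrier S"
  shows "gplus (iinv S u) = rstar T (\<gamma> u)"
proof -
  define d where "d = inv_star S u"
  have d: "d \<in> idems S" "d \<in> carrier S" "iinv S u \<otimes> u = d" "d \<otimes> iinv S u = iinv S u"
      "inv_plus S (iinv S u) = d"
    using u S.inv_star_idem[OF u] by (simp_all add: d_def inv_star_def inv_plus_def S.m_assoc)
  have eq: "gplus (iinv S u) \<otimes>\<^bsub>T\<^esub> \<gamma> d = \<gamma> d \<otimes>\<^bsub>T\<^esub> rstar T (\<gamma> u)"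
    using gamma_plus[of "iinv S u" u] gamma_star[of "iinv S u" u] u d by simp
  have "gplus (iinv S u) = gplus (iinv S u) \<otimes>\<^bsub>T\<^esub> gplus d"
    using gplus_inv_plus[of "iinv S u"] d u T.projs_comm[of "gplus (iinv S u)" "gplus d"] by simp
  also have "\<dots> = rplus T (\<gamma> d \<otimes>\<^bsub>T\<^esub> rstar T (\<gamma> u))"
    using d u by (simp add: T.rplus_mult flip: eq)
  also have "\<dots> = gplus d \<otimes>\<^bsub>T\<^esub> rstar T (\<gamma> u)"
    using T.idempotent_mult_proj[OF _ gamma_idem[OF d(1)]] d u by simp
  also have "\<dots> = rstar T (\<gamma> d) \<otimes>\<^bsub>T\<^esub> rstar T (\<gamma> u)"
    using T.idempotent_rstar_eq_rplus[OF _ gamma_idem[OF d(1)]] d by simp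
  also have "\<dots> = rstar T (\<gamma> u)"
    using rstar_inv_star[OF u] T.rstar_comm[of "\<gamma> d" "\<gamma> u"] d u by (simp add: d_def)
  finally show ?thesis .
qed

text \<open>Apply \<open>gplus_idem_mult\<close> factor by factor, keeping \<open>gplus g\<close>
  available throughout.\<close>

lemma plus_prod_image_idem:
  assumes g: "g \<in> idems S" and "finite A" "A \<subseteq> carrier S"
  shows "gplus g \<otimes>\<^bsub>T\<^esub> plus_prod (mult S g ` A) = gplus g \<otimes>\<^bsub>T\<^esub> plus_prod A"
  using assms(2,3)
proof induction
  case (insert a A)
  note c = S.idems_closed[OF g]
  have A: "a \<in> carrier S" "A \<subseteq> carrier S" "mult S g ` A \<subseteq> carrier S" using insert c by auto
  note q = plus_prod_in_projs[OF A(2)] plus_prod_in_projs[OF A(3)] plus_prod_closed[OF A(2)] plus_prod_closed[OF A(3)]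
  have "gplus g \<otimes>\<^bsub>T\<^esub> plus_prod (mult S g ` insert a A) = gplus g \<otimes>\<^bsub>T\<^esub> gplus (g \<otimes> a) \<otimes>\<^bsub>T\<^esub> plus_prod (mult S g ` A)"
    using A c q insert by (simp add: plus_prod_insert T.m_assoc)
  also have "\<dots> = gplus a \<otimes>\<^bsub>T\<^esub> (gplus g \<otimes>\<^bsub>T\<^esub> plus_prod (mult S g ` A))"
    using A c q gplus_idem_mult[OF g A(1)] T.projs_comm[of "gplus g" "gplus a"] by (simp add: T.m_assoc[symmetric])
  also have "\<dots> = gplus g \<otimes>\<^bsub>T\<^esub> plus_prod (insert a A)"
    using A c q insert T.projs_left_comm[of "gplus g" "gplus a" "plus_prod A"] by (simp add: plus_prod_insert)
  finally show ?case .
qed simp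

text \<open>For an idempotent \<open>(A, e)\<close> the factor \<open>gplus e\<close> is already
  included, as \<open>e \<in> A\<close>.\<close>

definition plus_prod_fst :: "'a set \<times> 'a \<Rightarrow> 'c" where
  "plus_prod_fst x = plus_prod (fst x)"

lemma plus_prod_fst_in_projs: "x \<in> idems (Spr S) \<Longrightarrow> plus_prod_fst x \<in> projs T"
  unfolding plus_prod_fst_def by (cases x) (auto dest: S.idems_SprD(3) intro!: plus_prod_in_projs)

text \<open>The set of the product contains \<open>g = ef\<close>, the image of \<open>e\<close>.
  The factor \<open>gplus g\<close> may thus be added, used to remove the translation by
  \<open>g\<close>, and then split into \<open>gplus e\<close> and \<open>gplus f\<close>, which the
  product over \<open>A \<union> B\<close> absorbs.\<close>

lemma plus_prod_fst_mult:
  assumes "x \<in> idems (Spr S)" "y \<in> idems (Spr S)"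
  shows "plus_prod_fst (x \<otimes>\<^bsub>Spr S\<^esub> y) = plus_prod_fst x \<otimes>\<^bsub>T\<^esub> plus_prod_fst y"
proof -
  obtain A e where x: "x = (A, e)" by (metis surj_pair)
  obtain B f where y: "y = (B, f)" by (metis surj_pair)
  note A = S.idems_SprD(1-5)[OF assms(1)[unfolded x]] and B = S.idems_SprD(1-5)[OF assms(2)[unfolded y]]
  let ?C = "A \<union> B" and ?g = "e \<otimes> f"
  have g: "?g \<in> idems S" "?g \<in> carrier S" "?g \<in> mult S ?g ` ?C"
    using A B by (auto simp: S.idems_mult S.idems_comm[OF A(1) B(1)] S.m_assoc S.idems_idem
        intro!: image_eqI[of _ _ e])
  have C: "finite ?C" "?C \<subseteq> carrier S" "mult S ?g ` ?C \<subseteq> carrier S" "finite (mult S ?g ` ?C)"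
    using A B g by auto
  note c = plus_prod_closed[OF C(2)] plus_prod_closed[OF C(3)]
  have "plus_prod (mult S ?g ` ?C) = gplus ?g \<otimes>\<^bsub>T\<^esub> plus_prod (mult S ?g ` ?C)"
    using plus_prod_absorb[OF C(4,3) g(3)] by simp
  also have "\<dots> = gplus ?g \<otimes>\<^bsub>T\<^esub> plus_prod ?C"
    by (rule plus_prod_image_idem[OF g(1) C(1,2)])
  also have "\<dots> = gplus e \<otimes>\<^bsub>T\<^esub> (gplus f \<otimes>\<^bsub>T\<^esub> plus_prod ?C)"
    using gplus_mult_idems[OF A(1) B(1)] A B c by (simp add: T.m_assoc)
  also have "\<dots> = plus_prod ?C"
    using plus_prod_absorb[OF C(1,2), of e] plus_prod_absorb[OF C(1,2), of f] A B by simp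
  also have "\<dots> = plus_prod A \<otimes>\<^bsub>T\<^esub> plus_prod B"
    using A B by (simp add: plus_prod_union)
  finally show ?thesis
    using S.idems_Spr_mult[of A e B f] assms unfolding x y plus_prod_fst_def by simp
qed

lemma plus_prod_fst_pr_gen:
  assumes s: "s \<in> carrier S"
  shows "plus_prod_fst (inv_plus (Spr S) (pr_gen S s)) = gplus s"
  using s gplus_inv_plus[OF s] T.projs_comm[of "gplus s" "gplus (inv_plus S s)"]
  by (simp add: plus_prod_fst_def S.inv_plus_pr_gen plus_prod_insert)

text \<open>The set of \<open>[s]y\<close> is \<open>sB\<close> together with
  \<open>?r = inv_plus S (s \<otimes> f)\<close>, because
  \<open>?r \<otimes> s = s \<otimes> f\<close> is already in \<open>sB\<close>. The factor of
  \<open>?r\<close> is absorbed by that of \<open>s \<otimes> f\<close>, leaving the product over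
  \<open>sB\<close>.\<close>

lemma plus_prod_fst_act:
  assumes s: "s \<in> carrier S" and y: "y \<in> idems (Spr S)"
  shows "\<gamma> s \<otimes>\<^bsub>T\<^esub> plus_prod_fst y = plus_prod_fst (inv_plus (Spr S) (pr_gen S s \<otimes>\<^bsub>Spr S\<^esub> y)) \<otimes>\<^bsub>T\<^esub> \<gamma> s"
proof -
  obtain B f where By: "y = (B, f)" by (metis surj_pair)
  note B = S.idems_SprD(1-5)[OF y[unfolded By]]
  let ?r = "inv_plus S (s \<otimes> f)" and ?C = "mult S s ` B"
  have sy: "pr_gen S s \<otimes>\<^bsub>Spr S\<^esub> y \<in> carrier (Spr S)"
    using s y by (intro Spr.m_closed S.pr_gen_closed Spr.idems_closed)
  have sf: "s \<otimes> f \<in> ?C" "s \<otimes> f \<in> carrier S" using B s by auto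
  have C: "finite ?C" "?C \<subseteq> carrier S" using B s by auto
  have "?r \<otimes> s = s \<otimes> f"
    using S.inv_plus_ample[OF s B(2)] S.inv_plus_of_idem[OF B(1)] by simp
  moreover have "?r \<otimes> inv_plus S s = ?r"
    using s B by (simp add: S.inv_plus_mult_absorb)
  ultimately have "fst (pr_gen S s \<otimes>\<^bsub>Spr S\<^esub> y) = insert ?r ?C"
    using sf(1) by (simp add: By pr_gen_def) auto
  then have "plus_prod_fst (inv_plus (Spr S) (pr_gen S s \<otimes>\<^bsub>Spr S\<^esub> y)) = plus_prod (insert ?r ?C)"
    using sy by (cases "pr_gen S s \<otimes>\<^bsub>Spr S\<^esub> y") (simp add: plus_prod_fst_def S.inv_plus_Spr)
  also have "\<dots> = gplus ?r \<otimes>\<^bsub>T\<^esub> (gplus (s \<otimes> f) \<otimes>\<^bsub>T\<^esub> plus_prod ?C)"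
    using sf C by (simp add: plus_prod_insert plus_prod_absorb)
  also have "\<dots> = gplus ?r \<otimes>\<^bsub>T\<^esub> gplus (s \<otimes> f) \<otimes>\<^bsub>T\<^esub> plus_prod ?C"
    using sf plus_prod_closed[OF C(2)] by (simp add: T.m_assoc)
  also have "\<dots> = plus_prod ?C"
    using sf C by (simp add: gplus_inv_plus plus_prod_absorb)
  finally show ?thesis
    using gamma_plus_prod[OF s B(4,3)] by (simp add: By plus_prod_fst_def)
qed

definition normal_form :: "('a set \<times> 'a) \<times> 'a \<Rightarrow> 'c" where
  "normal_form = (\<lambda>(x, s). plus_prod_fst x \<otimes>\<^bsub>T\<^esub> \<gamma> s)"

lemma normal_form_simp [simp]: "normal_form (x, s) = plus_prod_fst x \<otimes>\<^bsub>T\<^esub> \<gamma> s"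
  by (simp add: normal_form_def)

text \<open>As \<open>u u^-1 A = A\<close>, the product over \<open>A\<close> can be moved to the
  right of \<open>\<gamma> u\<close>, becoming the product over \<open>u^-1 A\<close>. The remaining
  \<open>rstar T (\<gamma> u)\<close> is \<open>gplus (iinv S u)\<close>, a factor already
  present.\<close>

lemma rstar_plus_prod_gamma:
  assumes A: "(A, u) \<in> carrier (Spr S)"
  shows "rstar T (plus_prod A \<otimes>\<^bsub>T\<^esub> \<gamma> u) = plus_prod (mult S (iinv S u) ` A)"
proof -
  note a = Spr_carrierD(1-5)[OF A]
  let ?B = "mult S (iinv S u) ` A"
  have B: "finite ?B" "?B \<subseteq> carrier S" using a by auto
  have i: "iinv S u \<in> ?B"
    using Spr_carrierD(4)[OF S.Spr_iinv_closed[OF A]] by simp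
  have "mult S u ` ?B = A"
    using a S.Spr_image[OF A] by (simp add: S.image_mult_mult flip: inv_plus_def[of S u])
  then have "rstar T (plus_prod A \<otimes>\<^bsub>T\<^esub> \<gamma> u) = rstar T (\<gamma> u \<otimes>\<^bsub>T\<^esub> plus_prod ?B)"
    using gamma_plus_prod[OF a(1) B] by simp
  also have "\<dots> = gplus (iinv S u) \<otimes>\<^bsub>T\<^esub> plus_prod ?B"
    using a plus_prod_in_projs[OF B(2)] by (simp add: T.rstar_mult_proj gplus_iinv)
  finally show ?thesis
    using plus_prod_absorb[OF B i] by simp
qed

text \<open>Since \<open>eA = A\<close>, the product over \<open>A\<close> commutes with
  \<open>\<gamma> e\<close>, so \<open>x\<close> is idempotent, and \<open>plus_prod A\<close> is
  its \<open>rplus\<close>, hence its \<open>rstar\<close>. Under \<open>rstar\<close> the product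
  may therefore be replaced by \<open>x\<close>, whose factor \<open>\<gamma> e\<close> merges with
  \<open>\<gamma> s\<close> into \<open>\<gamma> (e \<otimes> s)\<close>.\<close>

lemma rstar_plus_prod_gamma_idem:
  assumes "finite A" "A \<subseteq> carrier S" and e: "e \<in> idems S" "e \<in> A"
    and eA: "mult S e ` A = A" and s: "s \<in> carrier S"
  shows "rstar T (plus_prod A \<otimes>\<^bsub>T\<^esub> \<gamma> s) = rstar T (plus_prod A \<otimes>\<^bsub>T\<^esub> \<gamma> (e \<otimes> s))"
proof -
  note c = S.idems_closed[OF e(1)] plus_prod_closed[OF assms(2)]
  define x where "x = plus_prod A \<otimes>\<^bsub>T\<^esub> \<gamma> e"
  have xc: "x \<in> carrier T" using c by (simp add: x_def)
  have comm: "\<gamma> e \<otimes>\<^bsub>T\<^esub> plus_prod A = plus_prod A \<otimes>\<^bsub>T\<^esub> \<gamma> e"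
    using gamma_plus_prod[OF c(1) assms(1,2)] eA by simp
  have "x \<otimes>\<^bsub>T\<^esub> x = plus_prod A \<otimes>\<^bsub>T\<^esub> (\<gamma> e \<otimes>\<^bsub>T\<^esub> plus_prod A) \<otimes>\<^bsub>T\<^esub> \<gamma> e"
    using c by (simp add: x_def T.m_assoc)
  also have "\<dots> = plus_prod A \<otimes>\<^bsub>T\<^esub> (plus_prod A \<otimes>\<^bsub>T\<^esub> (\<gamma> e \<otimes>\<^bsub>T\<^esub> \<gamma> e))"
    unfolding comm using c by (simp add: T.m_assoc)
  also have "\<dots> = x"
    using c gamma_idem[OF e(1)] plus_prod_in_projs[OF assms(2)] by (simp add: x_def T.projs_idem_left)
  finally have "rstar T x = rplus T x"
    by (rule T.idempotent_rstar_eq_rplus[OF xc])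
  also have "\<dots> = plus_prod A"
    using plus_prod_absorb[OF assms(1,2) e(2)] plus_prod_in_projs[OF assms(2)] c T.projs_comm[of "plus_prod A" "gplus e"]
    by (simp add: x_def T.rplus_proj_mult)
  finally have "rstar T (plus_prod A \<otimes>\<^bsub>T\<^esub> \<gamma> s) = rstar T (x \<otimes>\<^bsub>T\<^esub> \<gamma> s)"
    using T.rstar_rstar_mult[OF xc, of "\<gamma> s"] s by simp
  also have "x \<otimes>\<^bsub>T\<^esub> \<gamma> s = plus_prod A \<otimes>\<^bsub>T\<^esub> gplus e \<otimes>\<^bsub>T\<^esub> \<gamma> (e \<otimes> s)"
    using c s by (simp add: x_def T.m_assoc gamma_plus)
  also have "plus_prod A \<otimes>\<^bsub>T\<^esub> gplus e = plus_prod A"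
    using plus_prod_absorb[OF assms(1,2) e(2)] plus_prod_in_projs[OF assms(2)] c T.projs_comm[of "plus_prod A" "gplus e"] by simp
  finally show ?thesis .
qed

section \<open>The normal form map is a morphism\<close>

lemma EprS_carrier:
  "(x, s) \<in> carrier (EprS S) \<longleftrightarrow> x \<in> idems (Spr S) \<and> s \<in> carrier S \<and>
     x = x \<otimes>\<^bsub>Spr S\<^esub> inv_plus (Spr S) (pr_gen S s)"
  by (simp add: EprS_def idem_le_def)

lemma EprS_simps:
  "(x, s) \<otimes>\<^bsub>EprS S\<^esub> (y, t) =
     (x \<otimes>\<^bsub>Spr S\<^esub> inv_plus (Spr S) (pr_gen S s \<otimes>\<^bsub>Spr S\<^esub> y), s \<otimes> t)"
  "\<one>\<^bsub>EprS S\<^esub> = (\<one>\<^bsub>Spr S\<^esub>, \<one>)"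
  "rstar (EprS S) (x, s) = (inv_star (Spr S) (x \<otimes>\<^bsub>Spr S\<^esub> pr_gen S s), \<one>)"
  "rplus (EprS S) (x, s) = (x, \<one>)"
  by (simp_all add: EprS_def)

lemma EprS_absorb:
  assumes "(x, s) \<in> carrier (EprS S)"
  shows "plus_prod_fst x \<otimes>\<^bsub>T\<^esub> gplus s = plus_prod_fst x"
proof -
  have x: "x \<in> idems (Spr S)" "s \<in> carrier S" "x = x \<otimes>\<^bsub>Spr S\<^esub> inv_plus (Spr S) (pr_gen S s)"
    using assms by (simp_all add: EprS_carrier)
  have "plus_prod_fst (x \<otimes>\<^bsub>Spr S\<^esub> inv_plus (Spr S) (pr_gen S s)) = plus_prod_fst x \<otimes>\<^bsub>T\<^esub> gplus s"
    using x(1,2) by (simp add: plus_prod_fst_mult plus_prod_fst_pr_gen S.pr_gen_closed)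
  then show ?thesis using x(3) by simp
qed

lemma normal_form_rstar:
  assumes "(x, s) \<in> carrier (EprS S)"
  shows "normal_form (rstar (EprS S) (x, s)) = rstar T (normal_form (x, s))"
proof -
  have x: "x \<in> idems (Spr S)" "s \<in> carrier S" "x = x \<otimes>\<^bsub>Spr S\<^esub> inv_plus (Spr S) (pr_gen S s)"
    using assms by (simp_all add: EprS_carrier)
  obtain A e where Ax: "x = (A, e)" by (metis surj_pair)
  note A = S.idems_SprD(1-5,7)[OF x(1)[unfolded Ax]]
  have r: "({s, inv_plus S s}, inv_plus S s) \<in> idems (Spr S)"
    using Spr.inv_plus_idem[OF S.pr_gen_closed[OF x(2)]] S.inv_plus_pr_gen[OF x(2)] by simp
  \<comment> \<open>Comparing components in the membership condition yields
    \<open>e s s^-1 = e\<close> and \<open>es \<in> A\<close>. Hence \<open>x\<close> times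
    \<open>pr_gen S s\<close> is \<open>(A, e \<otimes> s)\<close>, an element to which
    \<open>rstar_plus_prod_gamma\<close> applies.\<close>
  have "x = (mult S (e \<otimes> inv_plus S s) ` (A \<union> {s, inv_plus S s}), e \<otimes> inv_plus S s)"
    using x(3) S.idems_Spr_mult[OF x(1)[unfolded Ax] r]
    unfolding S.inv_plus_pr_gen[OF x(2)] Ax by (rule HOL.trans)
  then have er: "e \<otimes> inv_plus S s = e" and "A = mult S e ` (A \<union> {s, inv_plus S s})"
    unfolding Ax by auto
  then have es: "e \<otimes> s \<in> A" by blast
  have res: "inv_plus S (e \<otimes> s) = e"
    using S.inv_plus_mult[OF A(1) x(2)] er by simp
  have xs: "x \<otimes>\<^bsub>Spr S\<^esub> pr_gen S s = (A, e \<otimes> s)"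
    using A(5,6) es by (simp add: Ax pr_gen_def res er insert_absorb)
  have xc: "(A, e \<otimes> s) \<in> carrier (Spr S)"
    using Spr.m_closed[OF Spr.idems_closed[OF x(1)] S.pr_gen_closed[OF x(2)]] xs by simp
  have "rstar T (normal_form (x, s)) = rstar T (plus_prod A \<otimes>\<^bsub>T\<^esub> \<gamma> (e \<otimes> s))"
    using rstar_plus_prod_gamma_idem[OF A(4,3,1,5,6) x(2)] by (simp add: Ax plus_prod_fst_def)
  also have "\<dots> = plus_prod (mult S (iinv S (e \<otimes> s)) ` A)"
    by (rule rstar_plus_prod_gamma[OF xc])
  also have "\<dots> = normal_form (rstar (EprS S) (x, s))"
    using plus_prod_closed[of "mult S (iinv S (e \<otimes> s)) ` A"] A x(2)
    by (simp add: EprS_simps xs S.inv_star_Spr[OF xc] plus_prod_fst_def image_subset_iff subset_eq)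
  finally show ?thesis by simp
qed

text \<open>The rearrangement of \<open>emb_mult\<close>, with \<open>plus_prod_fst_act\<close>
  translating the action on projections into the one in \<open>Spr S\<close>.\<close>

lemma normal_form_mult:
  assumes "(x, s) \<in> carrier (EprS S)" "(y, t) \<in> carrier (EprS S)"
  shows "normal_form ((x, s) \<otimes>\<^bsub>EprS S\<^esub> (y, t)) = normal_form (x, s) \<otimes>\<^bsub>T\<^esub> normal_form (y, t)"
proof -
  have x: "x \<in> idems (Spr S)" "s \<in> carrier S" and y: "y \<in> idems (Spr S)" "t \<in> carrier S"
    using assms by (simp_all add: EprS_carrier)
  define z where "z = inv_plus (Spr S) (pr_gen S s \<otimes>\<^bsub>Spr S\<^esub> y)"
  have z: "z \<in> idems (Spr S)"
    using x y by (simp add: z_def S.pr_gen_closed Spr.idems_closed)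
  note q = plus_prod_fst_in_projs[OF x(1)] plus_prod_fst_in_projs[OF y(1)] plus_prod_fst_in_projs[OF z]
  note c = q[THEN T.projs_closed]
  have "normal_form (x, s) \<otimes>\<^bsub>T\<^esub> normal_form (y, t) = plus_prod_fst x \<otimes>\<^bsub>T\<^esub> (\<gamma> s \<otimes>\<^bsub>T\<^esub> plus_prod_fst y) \<otimes>\<^bsub>T\<^esub> \<gamma> t"
    using x y c by (simp add: T.m_assoc)
  also have "\<dots> = plus_prod_fst x \<otimes>\<^bsub>T\<^esub> (plus_prod_fst z \<otimes>\<^bsub>T\<^esub> (\<gamma> s \<otimes>\<^bsub>T\<^esub> \<gamma> t))"
    unfolding plus_prod_fst_act[OF x(2) y(1)] z_def[symmetric] using x y c by (simp add: T.m_assoc)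
  also have "\<dots> = plus_prod_fst z \<otimes>\<^bsub>T\<^esub> (plus_prod_fst x \<otimes>\<^bsub>T\<^esub> gplus s \<otimes>\<^bsub>T\<^esub> \<gamma> (s \<otimes> t))"
    using x y c q by (simp add: T.m_assoc T.projs_left_comm[of "plus_prod_fst x" "plus_prod_fst z"] gamma_plus)
  also have "\<dots> = plus_prod_fst z \<otimes>\<^bsub>T\<^esub> (plus_prod_fst x \<otimes>\<^bsub>T\<^esub> \<gamma> (s \<otimes> t))"
    unfolding EprS_absorb[OF assms(1)] ..
  also have "\<dots> = normal_form ((x, s) \<otimes>\<^bsub>EprS S\<^esub> (y, t))"
    using x y c q z
    by (simp add: EprS_simps z_def[symmetric] plus_prod_fst_mult T.m_assoc T.projs_left_comm[of "plus_prod_fst x" "plus_prod_fst z"])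
  finally show ?thesis by simp
qed

lemma normal_form_hom: "normal_form \<in> restriction_hom (EprS S) T"
proof -
  have c: "plus_prod_fst x \<in> carrier T" if "x \<in> idems (Spr S)" for x
    using plus_prod_fst_in_projs[OF that] by (rule T.projs_closed)
  have "normal_form (rplus (EprS S) (x, s)) = rplus T (normal_form (x, s))" if "(x, s) \<in> carrier (EprS S)" for x s
    using EprS_absorb[OF that] that plus_prod_fst_in_projs[of x] c[of x]
    by (simp add: EprS_carrier EprS_simps T.rplus_proj_mult)
  moreover have "normal_form \<one>\<^bsub>EprS S\<^esub> = \<one>\<^bsub>T\<^esub>"
    by (simp add: EprS_simps plus_prod_fst_def plus_prod_singleton T.rplus_proj)
  moreover have "normal_form (x, s) \<in> carrier T" if "(x, s) \<in> carrier (EprS S)" for x s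
    using that c by (simp add: EprS_carrier)
  ultimately show ?thesis
    using normal_form_mult normal_form_rstar by (auto simp: restriction_hom_def simp del: normal_form_simp)
qed

end

section \<open>The isomorphism\<close>

lemma restriction_homD:
  assumes "f \<in> restriction_hom T U"
  shows "x \<in> carrier T \<Longrightarrow> f x \<in> carrier U"
    "x \<in> carrier T \<Longrightarrow> y \<in> carrier T \<Longrightarrow> f (x \<otimes>\<^bsub>T\<^esub> y) = f x \<otimes>\<^bsub>U\<^esub> f y"
    "x \<in> carrier T \<Longrightarrow> f (rstar T x) = rstar U (f x)"
    "x \<in> carrier T \<Longrightarrow> f (rplus T x) = rplus U (f x)"
    "f \<one>\<^bsub>T\<^esub> = \<one>\<^bsub>U\<^esub>"
  using assms by (auto simp: restriction_hom_def)

lemma strong_premorphism_FR_Rs: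
  assumes "monoid S"
  shows "strong_premorphism S (FR_Rs S) (\<lambda>s. rclass (carrier S) (strong_rels S) (Gen s))"
proof -
  interpret S: monoid S by fact
  interpret T: restriction_monoid "FR_Rs S"
    unfolding FR_Rs_def by (rule restriction_monoid_presented)
  have rel: "rclass (carrier S) (strong_rels S) u = rclass (carrier S) (strong_rels S) v"
    if "(u, v) \<in> strong_rels S" "u \<in> rterms (carrier S)" "v \<in> rterms (carrier S)" for u v
    using that by (intro rclass_eq rcong.rel)
  show ?thesis
  proof
    show "rclass (carrier S) (strong_rels S) (Gen s) \<in> carrier (FR_Rs S)" if "s \<in> carrier S" for s
      using that by (auto simp: FR_Rs_def presented_carrier)
  qed (simp_all add: FR_Rs_def, (rule rel; force simp: strong_rels_def)+)
qed

lemma (in strong_premorphism) rterm_eval_strong_rels: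
  assumes "(u, v) \<in> strong_rels S"
  shows "rterm_eval T \<gamma> u = rterm_eval T \<gamma> v"
  using assms gamma_plus gamma_star by (auto simp: strong_rels_def)

context inverse_monoid
begin

interpretation Spr: inverse_monoid "Spr S"
  by (rule inverse_monoid_Spr)

interpretation pr: strong_premorphism S "inv_restriction (Spr S)" "pr_gen S"
  by (rule strong_premorphism_pr_gen)

definition epr_gen :: "'a \<Rightarrow> ('a set \<times> 'a) \<times> 'a" where
  "epr_gen s = (inv_plus (Spr S) (pr_gen S s), s)"

lemma strong_premorphism_epr_gen: "strong_premorphism S (EprS S) epr_gen"
  using pr.strong_premorphism_semidirect by (simp add: EprS_eq epr_gen_def[abs_def])

interpretation W: strong_premorphism S "EprS S" epr_gen
  by (rule strong_premorphism_epr_gen)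

interpretation FR: inverse_strong_premorphism S "FR_Rs S"
  "\<lambda>s. rclass (carrier S) (strong_rels S) (Gen s)"
  by (intro inverse_strong_premorphism.intro strong_premorphism_FR_Rs inverse_monoid_axioms
      monoid_axioms)

definition FR_lift :: "'a rterm set \<Rightarrow> ('a set \<times> 'a) \<times> 'a" where
  "FR_lift = presented_lift (EprS S) epr_gen"

lemma FR_lift_rclass:
  "u \<in> rterms (carrier S) \<Longrightarrow>
    FR_lift (rclass (carrier S) (strong_rels S) u) = rterm_eval (EprS S) epr_gen u"
  unfolding FR_lift_def
  by (rule W.T.presented_lift_rclass) (auto intro: W.rterm_eval_strong_rels)

lemma FR_lift_hom: "FR_lift \<in> restriction_hom (FR_Rs S) (EprS S)"
  unfolding FR_lift_def FR_Rs_def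
  by (rule W.T.presented_lift_hom) (auto intro: W.rterm_eval_strong_rels)

text \<open>Injectivity of \<open>FR_lift\<close>: evaluation followed by the morphism
  \<open>normal_form\<close> fixes the classes of generators, hence every class, by induction on a
  representing term.\<close>

lemma normal_form_rterm_eval:
  "u \<in> rterms (carrier S) \<Longrightarrow>
    FR.normal_form (rterm_eval (EprS S) epr_gen u) = rclass (carrier S) (strong_rels S) u"
proof (induction u)
  case (Gen s)
  then show ?case
    using FR.T.rplus_left[OF FR.gamma_closed, of s]
    by (simp add: epr_gen_def FR.plus_prod_fst_pr_gen)
next
  case One
  then show ?case using restriction_homD(5)[OF FR.normal_form_hom] by (simp add: FR_Rs_def)
next
  case (Mul u v)
  then show ?case
    using restriction_homD(2)[OF FR.normal_form_hom] W.T.rterm_eval_closed[of epr_gen "carrier S"]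
    by (simp add: FR_Rs_def)
next
  case (Star u)
  then show ?case
    using restriction_homD(3)[OF FR.normal_form_hom] W.T.rterm_eval_closed[of epr_gen "carrier S"]
    by (simp add: FR_Rs_def)
next
  case (Plus u)
  then show ?case
    using restriction_homD(4)[OF FR.normal_form_hom] W.T.rterm_eval_closed[of epr_gen "carrier S"]
    by (simp add: FR_Rs_def)
qed

section \<open>The other composite: lifting normal forms\<close>

lemma FR_lift_gen: "s \<in> carrier S \<Longrightarrow> FR_lift (rclass (carrier S) (strong_rels S) (Gen s)) = epr_gen s"
  by (simp add: FR_lift_rclass)

lemma FR_lift_gplus:
  "s \<in> carrier S \<Longrightarrow> FR_lift (FR.gplus s) = (inv_plus (Spr S) (pr_gen S s), \<one>)"
  by (simp add: restriction_homD(4)[OF FR_lift_hom] FR_lift_gen epr_gen_def FR.EprS_simps)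

lemma pr_gen_one: "pr_gen S \<one> = \<one>\<^bsub>Spr S\<^esub>"
  using pr.gamma_one by simp

text \<open>Keeping \<open>e\<close> inserted makes every stage of the induction an idempotent of
  \<open>Spr S\<close>, with \<open>{e}\<close> as the starting set; a new \<open>b\<close>
  contributes \<open>({b, e}, e)\<close>.\<close>

lemma FR_lift_plus_prod:
  assumes e: "e \<in> idems S" and "finite B" "B \<subseteq> carrier S" "\<And>b. b \<in> B \<Longrightarrow> inv_plus S b = e"
  shows "FR_lift (FR.plus_prod (insert e B)) = ((insert e B, e), \<one>)"
  using assms(2-4)
proof (induction B)
  case empty
  then show ?case
    using idems_closed[OF e] by (simp add: FR.plus_prod_singleton FR_lift_gplus inv_plus_pr_gen inv_plus_of_idem[OF e])
next
  case (insert b B)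
  have c: "e \<in> carrier S" "b \<in> carrier S" "B \<subseteq> carrier S" "inv_plus S b = e" "finite B"
    using insert idems_closed[OF e] by auto
  have idem: "(insert e C, e) \<in> idems (Spr S)"
    if "C \<subseteq> insert b B" for C
  proof -
    have "finite C" "C \<subseteq> carrier S" "\<forall>a\<in>C. inv_plus S a = e"
      using that insert.prems c finite_subset[OF that] by auto
    then show ?thesis
      using e c(1) inv_plus_of_idem[OF e] by (simp add: idems_Spr Spr_carrier)
  qed
  note i = idem[of "{b}", simplified] idem[OF subset_insertI] idem[OF subset_refl]
  have "FR_lift (FR.plus_prod (insert e (insert b B))) = FR_lift (FR.gplus b \<otimes>\<^bsub>FR_Rs S\<^esub> FR.plus_prod (insert e B))"
    using c by (simp add: FR.plus_prod_insert insert_commute[of e b])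
  also have "\<dots> = (({b, e}, e), \<one>) \<otimes>\<^bsub>EprS S\<^esub> ((insert e B, e), \<one>)"
    using c insert by (simp add: restriction_homD(2)[OF FR_lift_hom] FR.plus_prod_closed FR_lift_gplus
        inv_plus_pr_gen)
  \<comment> \<open>A first factor with second component \<open>\<one>\<close> acts through
    \<open>pr_gen S \<one>\<close>, the identity of \<open>Spr S\<close>, so the product is that of
    the idempotents.\<close>
  also have "\<dots> = (({e, b}, e) \<otimes>\<^bsub>Spr S\<^esub> (insert e B, e), \<one>)"
    using i by (simp add: FR.EprS_simps pr_gen_one Spr.idems_closed Spr.inv_plus_of_idem insert_commute
        del: Spr_simps)
  also have "({e, b}, e) \<otimes>\<^bsub>Spr S\<^esub> (insert e B, e) = (mult S e ` ({e, b} \<union> insert e B), e)"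
    using i by (simp add: idems_Spr_mult idems_idem[OF e] del: Spr_simps)
  also have "{e, b} \<union> insert e B = insert e (insert b B)"
    by auto
  also have "mult S e ` insert e (insert b B) = insert e (insert b B)"
    using idems_SprD(7)[OF i(3)] by simp
  finally show ?case .
qed

text \<open>Surjectivity of \<open>FR_lift\<close>: the normal form lifts to
  \<open>(x, \<one>)\<close> times \<open>epr_gen s\<close>, and the membership condition says
  precisely that \<open>x\<close> absorbs the first component of \<open>epr_gen s\<close>.\<close>

lemma FR_lift_normal_form:
  assumes "(x, s) \<in> carrier (EprS S)"
  shows "FR_lift (FR.normal_form (x, s)) = (x, s)"
proof -
  have x: "x \<in> idems (Spr S)" "s \<in> carrier S" "x = x \<otimes>\<^bsub>Spr S\<^esub> inv_plus (Spr S) (pr_gen S s)"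
    using assms by (simp_all add: FR.EprS_carrier)
  obtain A e where Ax: "x = (A, e)" by (metis surj_pair)
  note A = idems_SprD(1-5)[OF x(1)[unfolded Ax]]
  have "FR_lift (FR.plus_prod A) = (x, \<one>)"
    using FR_lift_plus_prod[OF A(1,4,3)] idems_SprD(6)[OF x(1)[unfolded Ax]] A(5)
    by (simp add: Ax insert_absorb)
  then have "FR_lift (FR.normal_form (x, s)) = (x, \<one>) \<otimes>\<^bsub>EprS S\<^esub> epr_gen s"
    using A x(2) by (simp add: FR.plus_prod_fst_def Ax restriction_homD(2)[OF FR_lift_hom] FR.plus_prod_closed FR_lift_gen)
  also have "\<dots> = (x, s)"
    using x pr_gen_closed[OF x(2)]
    by (simp add: epr_gen_def FR.EprS_simps pr_gen_one Spr.idems_closed Spr.inv_plus_of_idem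
        flip: x(3) del: Spr_simps)
  finally show ?thesis .
qed

lemma bij_betw_FR_lift: "bij_betw FR_lift (carrier (FR_Rs S)) (carrier (EprS S))"
proof (rule bij_betw_byWitness[where f' = FR.normal_form])
  show "\<forall>a\<in>carrier (FR_Rs S). FR.normal_form (FR_lift a) = a"
  proof
    fix a assume "a \<in> carrier (FR_Rs S)"
    then obtain u where "u \<in> rterms (carrier S)" "a = rclass (carrier S) (strong_rels S) u"
      by (auto simp: FR_Rs_def presented_carrier)
    then show "FR.normal_form (FR_lift a) = a"
      by (simp only: FR_lift_rclass normal_form_rterm_eval)
  qed
  show "\<forall>a\<in>carrier (EprS S). FR_lift (FR.normal_form a) = a"
    using FR_lift_normal_form by (metis surj_pair)
qed (use restriction_homD(1)[OF FR_lift_hom] restriction_homD(1)[OF FR.normal_form_hom] in auto)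

lemma FR_Rs_iso_EprS: "FR_Rs S \<simeq>\<^sub>R EprS S"
  unfolding restriction_iso_def
  using bij_betw_FR_lift FR_lift_hom FR.T.restriction_monoid_axioms W.T.restriction_monoid_axioms
  by blast

end

theorem corollary8p10:
  fixes S :: "('a, 'b) monoid_scheme"
  assumes "inverse_monoid S"
  shows "FR_Rs S \<simeq>\<^sub>R EprS S"
  using assms by (rule inverse_monoid.FR_Rs_iso_EprS)

end
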